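(* Let $d\in\mathbb{N}$, let $T\in\mathbb{R}^{d\times d}$ be invertible and suppose the lattice $\mathbb{X}=T(\mathbb{Z}^d)$ is admissible. For $a>0$ and $\boldsymbol{\delta}\in\mathbb{R}^d$ let $$P_{a,\boldsymbol{\delta}}=\{a^{-1}(T\boldsymbol{k}-\boldsymbol{\delta}) : \boldsymbol{k}\in\mathbb{Z}^d\}\cap[0,1)^d .$$ For an integer $n\ge 2$, let $a_i=a_0n^i$ for all $i\in\mathbb{N}$ with some $a_0>0$, let $\boldsymbol{\delta}_i\in\mathbb{R}^d$ for all $i\in\mathbb{N}$, let $N_i=|P_{a_i,\boldsymbol{\delta}_i}|$, and assume $N_i\ge 2$ for all $i\in\mathbb{N}$. Then the set $\{P_{a_i,\boldsymbol{\delta}_i}\}_{i\ge1}$ is a quasi-uniform family of point sets whose star-discrepancy is of order of magnitude $(\log N_i)^{d-1}/N_i$, i.e., there is a constant $C>0$ independent of $i$ such that $$D_{N_i}^*(P_{a_i,\boldsymbol{\delta}_i})\le C\,\frac{(\log N_i)^{d-1}}{N_i}\qquad\text{for all } i\in\mathbb{N}.$$ Furthermore, if we take a common shift $\boldsymbol{\delta}\in\mathbb{R}^d$ and set $\boldsymbol{\delta}_i=\boldsymbol{\delta}$ for all $i$, the family is nested, i.e., $P_{a_i,\boldsymbol{\delta}}\subseteq P_{a_{i+1},\boldsymbol{\delta}}$ for all $i\in\mathbb{N}$.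
   Context: $T(\mathbb{Z}^d)=\{T\boldsymbol{k}:\boldsymbol{k}\in\mathbb{Z}^d\}$. A lattice $\mathbb{X}\subset\mathbb{R}^d$ is admissible if $\inf_{\boldsymbol{x}\in\mathbb{X}\setminus\{\boldsymbol{0}\}}\prod_{j=1}^d|x_j|>0$. For $p\in[1,\infty]$ and a finite set $P\subset[0,1]^d$ with $|P|\ge2$, put $h_p(P)=\sup_{\boldsymbol{x}\in[0,1]^d}\min_{\boldsymbol{y}\in P}\|\boldsymbol{x}-\boldsymbol{y}\|_p$ (covering radius), $q_p(P)=\min_{\boldsymbol{x}\ne\boldsymbol{y}\in P}\|\boldsymbol{x}-\boldsymbol{y}\|_p/2$ (separation radius), $\rho_p(P)=h_p(P)/q_p(P)$ (mesh ratio). A set $X$ of point sets in $[0,1]^d$ with $\sup_{P\in X}|P|=\infty$ is a quasi-uniform family if there is a constant $C_p>0$ with $\rho_p(P)\le C_p$ for all $P\in X$ (by equivalence of norms the property does not depend on $p\in[1,\infty]$). The star-discrepancy of an $N$-point set $P$ in $[0,1)^d$ is $D_N^*(P)=\sup_{\boldsymbol{a}\in[0,1]^d}\left|\frac{|P\cap[\boldsymbol{0},\boldsymbol{a})|}{N}-\prod_{j=1}^d a_j\right|$.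
   Formalization: The nestedness claim fails for a general common shift δ (d=1, T=1, a_0=1, n=2, δ=1/2); it is stated instead for δ with (n−1)δ in the lattice (necessary and sufficient here), and for all δ with δ_i = a_i δ, i.e. a common shift after rescaling. *)

theory Defs
  imports "HOL-Analysis.Analysis"
begin

definition lattice_of :: "real ^ 'd ^ 'd \<Rightarrow> (real ^ 'd) set" where
  "lattice_of T = range (\<lambda>k :: int ^ 'd. T *v (\<chi> j. of_int (k $ j)))"

definition admissible :: "(real ^ 'd) set \<Rightarrow> bool" where
  "admissible X \<longleftrightarrow> (INF x\<in>X - {0}. \<Prod>j\<in>UNIV. \<bar>x $ j\<bar>) > 0"

text \<open>Half-open boxes; the library's \<open>box\<close> is open and \<open>cbox\<close> is closed.
  The vectors \<open>0\<close> and \<open>1\<close> are constant, so \<open>cbox 0 1\<close> is the closed unit cube.\<close>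

definition half_open_box :: "real ^ 'd \<Rightarrow> real ^ 'd \<Rightarrow> (real ^ 'd) set" where
  "half_open_box u v = {x. \<forall>j. u $ j \<le> x $ j \<and> x $ j < v $ j}"

text \<open>The shift is applied before the scaling by \<open>1 / a\<close>. Consequently a common \<open>\<delta>\<close> makes the
  (nonempty) point sets for \<open>a\<close> and \<open>n * a\<close> nested only if \<open>(n - 1) *\<^sub>R \<delta>\<close> is a lattice vector,
  whereas the shifts \<open>a *\<^sub>R \<delta>\<close> and \<open>(n * a) *\<^sub>R \<delta>\<close> give nested point sets for every \<open>\<delta>\<close>.\<close>

definition lattice_points :: "real ^ 'd ^ 'd \<Rightarrow> real \<Rightarrow> real ^ 'd \<Rightarrow> (real ^ 'd) set" where
  "lattice_points T a \<delta> =
    {inverse a *\<^sub>R (x - \<delta>) | x. x \<in> lattice_of T} \<inter> half_open_box 0 1"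

text \<open>The \<open>\<ell>\<^sub>p\<close> norm for \<open>1 \<le> p \<le> \<infinity>\<close>; outside this range the value is irrelevant.\<close>

definition p_norm :: "ereal \<Rightarrow> real ^ 'd \<Rightarrow> real" where
  "p_norm p x =
    (if p = \<infinity> then infnorm x
     else (\<Sum>j\<in>UNIV. \<bar>x $ j\<bar> powr real_of_ereal p) powr (1 / real_of_ereal p))"

text \<open>The next three notions are meant for finite \<open>P\<close> with at least two points.\<close>

definition covering_radius :: "ereal \<Rightarrow> (real ^ 'd) set \<Rightarrow> real" where
  "covering_radius p P = (SUP x\<in>cbox 0 1. MIN y\<in>P. p_norm p (x - y))"

definition separation_radius :: "ereal \<Rightarrow> (real ^ 'd) set \<Rightarrow> real" where
  "separation_radius p P = Min {p_norm p (x - y) | x y. x \<in> P \<and> y \<in> P \<and> x \<noteq> y} / 2"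

definition mesh_ratio :: "ereal \<Rightarrow> (real ^ 'd) set \<Rightarrow> real" where
  "mesh_ratio p P = covering_radius p P / separation_radius p P"

definition quasi_uniform_family :: "ereal \<Rightarrow> (real ^ 'd) set set \<Rightarrow> bool" where
  "quasi_uniform_family p X \<longleftrightarrow>
    (\<forall>P\<in>X. finite P \<and> P \<subseteq> cbox 0 1 \<and> card P \<ge> 2) \<and>
    (SUP P\<in>X. enat (card P)) = \<infinity> \<and>
    (\<exists>C>0. \<forall>P\<in>X. mesh_ratio p P \<le> C)"

definition star_discrepancy :: "(real ^ 'd) set \<Rightarrow> real" where
  "star_discrepancy P =
    (SUP a\<in>cbox 0 1.
      \<bar>real (card (P \<inter> half_open_box 0 a)) / real (card P) - (\<Prod>j\<in>UNIV. a $ j)\<bar>)"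

end

theory Submission
  imports Defs "HOL-Real_Asymp.Real_Asymp"
begin

text \<open>Write \<open>X\<close> for the lattice and compare the number of points of \<open>X\<close> in two translates of an
  axis-parallel box \<open>B\<close>. Averaged over all translates this number is vol B / covol X, so it suffices to
  bound its oscillation by O((1 + log vol B)^(d - 1)). Admissibility survives diagonal scalings, so a
  box of volume \<open>v\<close> contains O(1 + v) lattice points whatever its aspect ratio, and \<open>X\<close> has \<open>d\<close>
  independent vectors of size O(v^(-1/d)) relative to the box. For a smooth bump with d + 1 bounded
  derivatives on a box of volume \<open>v \<ge> 1\<close>, the sum over a translate of \<open>X\<close> is periodic along these
  vectors, hence oscillates only by O(v * v^(-(d + 1)/d)) = O(v^(-1/d)). Each factor of the indicator
  of \<open>B\<close> is a dyadic sum of bumps near its two endpoints; scales are refined until the volume drops to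
  1. There are O(log^(d - 1)) scale vectors of each given volume, and the volumes contribute a
  geometric series.\<close>

section \<open>Functions with bounded derivatives\<close>

text \<open>The count of derivatives decides the exponent of the logarithm. With \<open>d\<close> of
  them, a product of bumps on volume \<open>v\<close> would contribute O(v * v^(-1)) = O(1), and all
  O(log^d) scale vectors of volume at least 1 would count fully. One derivative more makes large
  volumes negligible, so that the vectors of volume near 1 dominate. Refinement stops there because
  for smaller volume the short vectors are no longer small against the box and periodicity gives
  nothing, while the trivial count is already O(1). Translates are compared with each other, not
  with a volume, because oscillation is subadditive under the decomposition and the bumps need no
  integrals; the mean value enters once, for the finished box. Uniformity in the translation also
  makes all constants independent of the shifts. The scale vectors are never enumerated: one
  coordinate is split at a time, by induction on the number of coordinates that still carry an
  indicator.\<close>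

text \<open>The \<open>i\<close>-th derivative of \<open>f\<close> is bounded by \<open>K * \<eta> ^ i\<close> for all \<open>i \<le> p\<close>.\<close>

fun derivs_bounded :: "nat \<Rightarrow> real \<Rightarrow> real \<Rightarrow> (real \<Rightarrow> real) \<Rightarrow> bool" where
  "derivs_bounded 0 K \<eta> f \<longleftrightarrow> (\<forall>t. \<bar>f t\<bar> \<le> K)"
| "derivs_bounded (Suc p) K \<eta> f \<longleftrightarrow> (\<forall>t. \<bar>f t\<bar> \<le> K) \<and>
    (\<exists>f'. (\<forall>t. (f has_real_derivative f' t) (at t)) \<and> derivs_bounded p (K * \<eta>) \<eta> f')"

lemma derivs_bounded_SucI:
  assumes "\<And>t. \<bar>f t\<bar> \<le> K" "\<And>t. (f has_real_derivative f' t) (at t)"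
    "derivs_bounded p (K * \<eta>) \<eta> f'"
  shows "derivs_bounded (Suc p) K \<eta> f"
  using assms by auto

lemma derivs_bounded_abs_le: "derivs_bounded p K \<eta> f \<Longrightarrow> \<bar>f t\<bar> \<le> K"
  by (cases p) auto

lemma derivs_bounded_nonneg: "derivs_bounded p K \<eta> f \<Longrightarrow> 0 \<le> K"
  using derivs_bounded_abs_le[of p K \<eta> f 0] by linarith

lemma derivs_bounded_mono:
  assumes "derivs_bounded p K \<eta> f" "K \<le> K'" "0 \<le> \<eta>" "\<eta> \<le> \<eta>'"
  shows "derivs_bounded p K' \<eta>' f"
  using assms
proof (induction p arbitrary: K K' f)
  case 0
  then show ?case by (auto intro: order_trans)
next
  case (Suc p)
  then obtain f' where f': "\<And>t. (f has_real_derivative f' t) (at t)" "derivs_bounded p (K * \<eta>) \<eta> f'"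
    by auto
  have "0 \<le> K" using Suc.prems(1) by (rule derivs_bounded_nonneg)
  hence "derivs_bounded p (K' * \<eta>') \<eta>' f'"
    using Suc by (intro Suc.IH[OF f'(2)] mult_mono) auto
  then show ?case using f' Suc.prems by (auto intro: order_trans)
qed

lemma derivs_bounded_Suc_D: "derivs_bounded (Suc p) K \<eta> f \<Longrightarrow> derivs_bounded p K \<eta> f"
proof (induction p arbitrary: K f)
  case (Suc p)
  from Suc.prems obtain f' where "\<And>t. (f has_real_derivative f' t) (at t)"
    "derivs_bounded (Suc p) (K * \<eta>) \<eta> f'" by auto
  with Suc.IH[of "K * \<eta>" f'] Suc.prems show ?case by auto
qed auto

lemma derivs_bounded_add:
  "derivs_bounded p K \<eta> f \<Longrightarrow> derivs_bounded p L \<eta> g \<Longrightarrow> derivs_bounded p (K + L) \<eta> (\<lambda>t. f t + g t)"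
proof (induction p arbitrary: K L f g)
  case 0
  then show ?case by (auto intro: order_trans[OF abs_triangle_ineq add_mono])
next
  case (Suc p)
  from Suc.prems obtain f' g' where "\<And>t. (f has_real_derivative f' t) (at t)"
    "derivs_bounded p (K * \<eta>) \<eta> f'" "\<And>t. (g has_real_derivative g' t) (at t)"
    "derivs_bounded p (L * \<eta>) \<eta> g'" by auto
  then have "derivs_bounded p ((K + L) * \<eta>) \<eta> (\<lambda>t. f' t + g' t)"
    "\<And>t. ((\<lambda>t. f t + g t) has_real_derivative f' t + g' t) (at t)"
    using Suc.IH by (auto simp: distrib_right intro: derivative_intros)
  moreover have "\<bar>f t + g t\<bar> \<le> K + L" for t
    using Suc.prems[THEN derivs_bounded_abs_le, of t] by linarith
  ultimately show ?case by (intro derivs_bounded_SucI)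
qed

lemma derivs_bounded_cmult:
  "derivs_bounded p K \<eta> f \<Longrightarrow> derivs_bounded p (\<bar>a\<bar> * K) \<eta> (\<lambda>t. a * f t)"
proof (induction p arbitrary: K f)
  case 0
  then show ?case by (auto simp: abs_mult intro: mult_left_mono)
next
  case (Suc p)
  from Suc.prems obtain f' where "\<And>t. (f has_real_derivative f' t) (at t)"
    "derivs_bounded p (K * \<eta>) \<eta> f'" by auto
  then have "derivs_bounded p (\<bar>a\<bar> * K * \<eta>) \<eta> (\<lambda>t. a * f' t)"
    "\<And>t. ((\<lambda>t. a * f t) has_real_derivative a * f' t) (at t)"
    using Suc.IH[of "K * \<eta>" f'] by (auto simp: mult.assoc intro: DERIV_cmult)
  moreover have "\<bar>a * f t\<bar> \<le> \<bar>a\<bar> * K" for t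
    using derivs_bounded_abs_le[OF Suc.prems, of t] by (simp add: abs_mult mult_left_mono)
  ultimately show ?case by (intro derivs_bounded_SucI)
qed

lemma derivs_bounded_diff:
  assumes "derivs_bounded p K \<eta> f" "derivs_bounded p L \<eta> g"
  shows "derivs_bounded p (K + L) \<eta> (\<lambda>t. f t - g t)"
  using derivs_bounded_add[OF assms(1) derivs_bounded_cmult[OF assms(2), of "-1"]] by simp

text \<open>Leibniz rule: each differentiation doubles the number of summands, whence
  \<open>2 ^ p\<close>.\<close>

lemma derivs_bounded_mult:
  "derivs_bounded p K \<eta> f \<Longrightarrow> derivs_bounded p L \<eta> g \<Longrightarrow>
    derivs_bounded p (2 ^ p * (K * L)) \<eta> (\<lambda>t. f t * g t)"
proof (induction p arbitrary: K L f g)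
  case 0
  then show ?case by (auto simp: abs_mult intro!: mult_mono intro: order_trans[of 0 "\<bar>f 0\<bar>" K])
next
  case (Suc p)
  from Suc.prems obtain f' g' where d: "\<And>t. (f has_real_derivative f' t) (at t)"
    "derivs_bounded p (K * \<eta>) \<eta> f'" "\<And>t. (g has_real_derivative g' t) (at t)"
    "derivs_bounded p (L * \<eta>) \<eta> g'" by auto
  have "derivs_bounded p (2 ^ p * ((K * \<eta>) * L) + 2 ^ p * (K * (L * \<eta>))) \<eta> (\<lambda>t. f' t * g t + f t * g' t)"
    by (intro derivs_bounded_add Suc.IH d Suc.prems[THEN derivs_bounded_Suc_D])
  moreover have "2 ^ p * ((K * \<eta>) * L) + 2 ^ p * (K * (L * \<eta>)) = 2 ^ Suc p * (K * L) * \<eta>"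
    by (simp add: algebra_simps)
  moreover have "((\<lambda>t. f t * g t) has_real_derivative f' t * g t + f t * g' t) (at t)" for t
    using DERIV_mult[OF d(1) d(3), of t] by (simp only: mult.commute[of "g' t"])
  moreover have "\<bar>f t * g t\<bar> \<le> 2 ^ Suc p * (K * L)" for t
  proof -
    have "0 \<le> K" "0 \<le> L" "\<bar>f t\<bar> \<le> K" "\<bar>g t\<bar> \<le> L"
      using Suc.prems derivs_bounded_nonneg derivs_bounded_abs_le by blast+
    hence "\<bar>f t * g t\<bar> \<le> K * L" by (auto simp: abs_mult intro: mult_mono)
    also have "\<dots> \<le> 2 ^ Suc p * (K * L)"
      using mult_right_mono[of 1 "2 ^ Suc p" "K * L"] one_le_power[of "2::real" "Suc p"] \<open>0 \<le> K\<close> \<open>0 \<le> L\<close>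
      by simp
    finally show ?thesis .
  qed
  ultimately show ?case by (intro derivs_bounded_SucI) auto
qed

lemma derivs_bounded_zero: "derivs_bounded p 0 \<eta> (\<lambda>_. 0)"
  by (induction p) (auto intro!: exI[of _ "\<lambda>_. 0"])

lemma derivs_bounded_one: "0 \<le> \<eta> \<Longrightarrow> derivs_bounded p 1 \<eta> (\<lambda>_. 1)"
  using derivs_bounded_mono[OF derivs_bounded_zero, of \<eta> \<eta> \<eta>]
  by (cases p) (auto intro!: exI[of _ "\<lambda>_. 0"])

lemma derivs_bounded_prod:
  assumes "finite A" "0 \<le> \<eta>" "\<And>j. j \<in> A \<Longrightarrow> derivs_bounded p K \<eta> (f j)"
  shows "derivs_bounded p ((2 ^ p * K) ^ card A) \<eta> (\<lambda>t. \<Prod>j\<in>A. f j t)"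
  using assms(1,3)
proof (induction A rule: finite_induct)
  case empty
  then show ?case using derivs_bounded_one[OF assms(2)] by simp
next
  case (insert i A)
  then show ?case
    using derivs_bounded_mult[of p K \<eta> "f i" "(2 ^ p * K) ^ card A"] by (simp add: mult.assoc)
qed

text \<open>Chain rule. The slope goes into \<open>\<eta>\<close> and not into \<open>K\<close>, so
  a small slope gains a factor with every derivative; the smallness of lattice vectors relative to a
  box is used in this form.\<close>

lemma derivs_bounded_affine:
  "derivs_bounded p K \<eta> f \<Longrightarrow> derivs_bounded p K (\<eta> * \<bar>w\<bar>) (\<lambda>t. f (y + t * w))"
proof (induction p arbitrary: K f)
  case 0
  then show ?case by auto
next
  case (Suc p)
  from Suc.prems obtain f' where d: "\<And>t. (f has_real_derivative f' t) (at t)"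
    "derivs_bounded p (K * \<eta>) \<eta> f'" by auto
  have "((\<lambda>t. f (y + t * w)) has_real_derivative w * f' (y + t * w)) (at t)" for t
  proof -
    have "((\<lambda>t. y + t * w) has_real_derivative w) (at t)" by (auto intro!: derivative_eq_intros)
    from DERIV_chain2[OF d(1) this] show ?thesis by (simp add: mult.commute)
  qed
  moreover have "derivs_bounded p (K * (\<eta> * \<bar>w\<bar>)) (\<eta> * \<bar>w\<bar>) (\<lambda>t. w * f' (y + t * w))"
    using derivs_bounded_cmult[OF Suc.IH[OF d(2)], of w] by (simp add: mult_ac)
  ultimately show ?case using Suc.prems by (auto intro!: exI[of _ "\<lambda>t. w * f' (y + t * w)"])
qed

text \<open>The derivative of a periodic function is periodic and vanishes somewhere, so its values are
  bounded by its own oscillation; iterating, the oscillation is bounded by the highest derivative.\<close>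

lemma periodic_oscillation_le:
  assumes "derivs_bounded (Suc p) K \<eta> f" "\<And>t. f (t + 1) = f t"
  shows "\<bar>f t - f s\<bar> \<le> K * \<eta> ^ Suc p"
proof -
  have shift: "f (t + real_of_int k) = f t" if "\<And>t. f (t + 1) = f t" for f :: "real \<Rightarrow> real" and t k
  proof (induction k rule: int_induct[of _ 0])
    case (step1 i)
    then show ?case using that[of "t + real_of_int i"] by (simp add: add.assoc)
  next
    case (step2 i)
    then show ?case using that[of "t + real_of_int (i - 1)"] by (simp add: add.assoc)
  qed simp
  have osc: "\<bar>f t - f s\<bar> \<le> M"
    if f': "\<And>t. (f has_real_derivative f' t) (at t)" "\<And>t. \<bar>f' t\<bar> \<le> M" and per: "\<And>t. f (t + 1) = f t"
    for f f' :: "real \<Rightarrow> real" and t s M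
  proof -
    \<comment> \<open>By periodicity \<open>s\<close> may be moved to within one period to the left
      of \<open>t\<close>.\<close>
    define s' where "s' = s + real_of_int \<lfloor>t - s\<rfloor>"
    have s': "f s' = f s" "s' \<le> t" "t - s' \<le> 1" unfolding s'_def using shift[of f s, OF per] by (simp, linarith+)
    have "\<bar>f t - f s'\<bar> \<le> M * \<bar>t - s'\<bar>"
      using field_differentiable_bound[of UNIV f f' M t s'] f' by simp
    also have "\<dots> \<le> M * 1"
      using s' that(2)[of 0] by (intro mult_left_mono) auto
    finally show ?thesis using s' by simp
  qed
  show ?thesis
    using assms
  proof (induction p arbitrary: f K t s)
    case 0
    then obtain f' where "\<And>t. (f has_real_derivative f' t) (at t)" "\<And>t. \<bar>f' t\<bar> \<le> K * \<eta>"
      by auto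
    from osc[OF this 0(2)] show ?case by simp
  next
    case (Suc p)
    then obtain f' where f': "\<And>t. (f has_real_derivative f' t) (at t)"
      and sm: "derivs_bounded (Suc p) (K * \<eta>) \<eta> f'" by auto
    have per: "f' (t + 1) = f' t" for t
    proof -
      have "((\<lambda>t. f (t + 1)) has_real_derivative f' (t + 1)) (at t)"
        using f'[of "t + 1"] by (simp add: DERIV_shift)
      thus ?thesis using f'[of t] Suc.prems(2) by (auto intro: DERIV_unique)
    qed
    have "continuous_on {0..1} f"
      using f' DERIV_isCont by (blast intro: continuous_at_imp_continuous_on)
    then obtain z where "(f has_real_derivative 0) (at z)"
      using Rolle[of 0 1 f] f' Suc.prems(2)[of 0] by (auto simp: real_differentiable_def)
    hence "f' z = 0" using f' DERIV_unique by blast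
    hence "\<bar>f' t\<bar> \<le> K * \<eta> * \<eta> ^ Suc p" for t
      using Suc.IH[OF sm per, of t z] by simp
    from osc[OF f' this Suc.prems(2)] show ?case by (simp add: mult.assoc)
  qed
qed

text \<open>The relevant lattice points change with the shift, so no fixed finite index set serves.
  On an infinite support the value is the default 0.\<close>

definition fsum :: "('a \<Rightarrow> real) \<Rightarrow> real" where
  "fsum f = sum f {x. f x \<noteq> 0}"

lemma fsum_eq:
  assumes "finite Y" "{x. f x \<noteq> 0} \<subseteq> Y"
  shows "fsum f = sum f Y"
  unfolding fsum_def using assms by (intro sum.mono_neutral_left) auto

text \<open>Near each \<open>t\<close> the sum is one over a fixed finite set of at most
  \<open>Q\<close> indices, hence may be differentiated termwise. The count refers to a
  neighbourhood of \<open>t\<close>, not to \<open>t\<close> alone, so that the same index set works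
  for difference quotients and passes to the derivatives.\<close>

lemma derivs_bounded_fsum:
  assumes "\<And>x. derivs_bounded p K \<eta> (f x)"
    and "\<And>t. finite {x. \<exists>s. \<bar>s - t\<bar> < 1 \<and> f x s \<noteq> 0}"
    and "\<And>t. real (card {x. \<exists>s. \<bar>s - t\<bar> < 1 \<and> f x s \<noteq> 0}) \<le> Q"
  shows "derivs_bounded p (Q * K) \<eta> (\<lambda>t. fsum (\<lambda>x. f x t))"
  using assms
proof (induction p arbitrary: f K)
  case 0
  note prems = 0
  define Y where "Y t = {x. \<exists>s. \<bar>s - t\<bar> < 1 \<and> f x s \<noteq> 0}" for t
  have K: "0 \<le> K" using prems(1) derivs_bounded_nonneg by blast
  have "\<bar>fsum (\<lambda>x. f x t)\<bar> \<le> Q * K" for t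
  proof -
    have "fsum (\<lambda>x. f x t) = (\<Sum>x\<in>Y t. f x t)"
      using prems(2) by (intro fsum_eq) (auto simp: Y_def intro: exI[of _ t])
    also have "\<bar>\<dots>\<bar> \<le> (\<Sum>x\<in>Y t. K)"
      using prems(1) by (intro order_trans[OF sum_abs] sum_mono) auto
    also have "\<dots> \<le> Q * K"
      using prems(3)[of t] K by (auto simp: Y_def intro: mult_right_mono)
    finally show ?thesis .
  qed
  then show ?case by simp
next
  case (Suc p)
  note prems = Suc.prems
  define Y where "Y g t = {x. \<exists>s. \<bar>s - t\<bar> < 1 \<and> g x s \<noteq> 0}" for g :: "'a \<Rightarrow> real \<Rightarrow> real" and t
  have fin: "finite (Y f t)" for t using prems(2) by (simp add: Y_def)
  obtain f' where f': "\<And>x t. (f x has_real_derivative f' x t) (at t)"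
    "\<And>x. derivs_bounded p (K * \<eta>) \<eta> (f' x)"
  proof -
    have "\<forall>x. \<exists>f'. (\<forall>t. (f x has_real_derivative f' t) (at t)) \<and> derivs_bounded p (K * \<eta>) \<eta> f'"
      using prems(1) by simp
    from choice[OF this] show ?thesis using that by blast
  qed
  \<comment> \<open>A term that vanishes on the whole open interval around \<open>t\<close> has
    derivative 0 there, so the count is inherited by the family of derivatives.\<close>
  have sub: "Y f' t \<subseteq> Y f t" for t
  proof (rule ccontr)
    assume "\<not> Y f' t \<subseteq> Y f t"
    then obtain x s where x: "\<bar>s - t\<bar> < 1" "f' x s \<noteq> 0" "x \<notin> Y f t" unfolding Y_def by blast
    have "f x s = 0" if "s \<in> {t - 1<..<t + 1}" for s
      using that x(3) by (fastforce simp: Y_def abs_less_iff)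
    moreover have "s \<in> {t - 1<..<t + 1}" using x(1) by (auto simp: abs_less_iff)
    ultimately have "(f x has_real_derivative 0) (at s)"
      by - (rule has_field_derivative_transform_within_open
          [OF DERIV_const[where k = 0] open_greaterThanLessThan[of "t - 1" "t + 1"]], auto)
    from DERIV_unique[OF this f'(1)] x(2) show False by simp
  qed
  have "((\<lambda>t. fsum (\<lambda>x. f x t)) has_real_derivative fsum (\<lambda>x. f' x t)) (at t)" for t
  proof -
    have "((\<lambda>s. \<Sum>x\<in>Y f t. f x s) has_real_derivative (\<Sum>x\<in>Y f t. f' x t)) (at t)"
      using f' by (auto intro: DERIV_sum)
    moreover have "{x. f' x t \<noteq> 0} \<subseteq> Y f' t" by (force simp: Y_def)
    hence "fsum (\<lambda>x. f' x t) = (\<Sum>x\<in>Y f t. f' x t)"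
      using sub[of t] by (intro fsum_eq fin) (rule subset_trans)
    moreover have "fsum (\<lambda>x. f x s) = (\<Sum>x\<in>Y f t. f x s)" if "s \<in> {t - 1<..<t + 1}" for s
      using that fin by (intro fsum_eq) (auto simp: Y_def abs_less_iff intro!: exI[of _ s])
    ultimately show ?thesis
      using has_field_derivative_transform_within_open[of "\<lambda>s. \<Sum>x\<in>Y f t. f x s" _ t "{t - 1<..<t + 1}"
        "\<lambda>s. fsum (\<lambda>x. f x s)"] by auto
  qed
  moreover have "derivs_bounded p (Q * (K * \<eta>)) \<eta> (\<lambda>t. fsum (\<lambda>x. f' x t))"
  proof (rule Suc.IH[OF f'(2)])
    show "finite {x. \<exists>s. \<bar>s - t\<bar> < 1 \<and> f' x s \<noteq> 0}" for t
      using finite_subset[OF sub fin] by (simp add: Y_def)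
    show "real (card {x. \<exists>s. \<bar>s - t\<bar> < 1 \<and> f' x s \<noteq> 0}) \<le> Q" for t
      using card_mono[OF fin sub, of t] prems(3)[of t] by (simp add: Y_def)
  qed
  moreover have "\<bar>fsum (\<lambda>x. f x t)\<bar> \<le> Q * K" for t
    by (rule derivs_bounded_abs_le, rule Suc.IH[OF derivs_bounded_Suc_D[OF prems(1)] prems(2,3)])
  ultimately show ?case
    by (intro derivs_bounded_SucI) (simp_all only: mult.assoc)
qed

text \<open>Repeated averaging over unit intervals: each integration gains one derivative.\<close>

lemma smooth_step_exists:
  "\<exists>\<sigma>. continuous_on UNIV \<sigma> \<and> derivs_bounded p (2 ^ p) 1 \<sigma> \<and>
    (\<forall>y\<le>0. \<sigma> y = 0) \<and> (\<forall>y\<ge>real p + 1. \<sigma> y = 1) \<and> (\<forall>y. 0 \<le> \<sigma> y \<and> \<sigma> y \<le> 1)"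
proof (induction p)
  case 0
  show ?case
    by (rule exI[of _ "\<lambda>y. max 0 (min 1 y)"]) (auto intro!: continuous_intros)
next
  case (Suc p)
  then obtain \<sigma> where cont: "continuous_on UNIV \<sigma>" and sm: "derivs_bounded p (2 ^ p) 1 \<sigma>"
    and 0: "\<And>y. y \<le> 0 \<Longrightarrow> \<sigma> y = 0" and 1: "\<And>y. y \<ge> real p + 1 \<Longrightarrow> \<sigma> y = 1"
    and r: "\<And>y. 0 \<le> \<sigma> y" "\<And>y. \<sigma> y \<le> 1" by blast
  \<comment> \<open>The mean over the preceding unit interval lengthens the transition region by 1.
    Its derivative is a difference of two translates of \<open>\<sigma>\<close>, which doubles the
    constant.\<close>
  define F where "F y = integral {y - 1..y} \<sigma>" for y
  have int: "\<sigma> integrable_on {a..b}" for a b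
    using cont by (intro integrable_continuous_real) (auto intro: continuous_on_subset)
  have der: "(F has_real_derivative \<sigma> y - \<sigma> (y - 1)) (at y)" for y
  proof -
    \<comment> \<open>With a base point well to the left, \<open>F\<close> is near \<open>y\<close>
      a difference of two values of one antiderivative.\<close>
    define J where "J = (\<lambda>z. integral {y - 3..z} \<sigma>)"
    have J: "(J has_real_derivative \<sigma> z) (at z)" if "z \<in> {y - 3<..<y + 3}" for z
      using integral_has_real_derivative[of "y - 3" "y + 3" \<sigma> z] that continuous_on_subset[OF cont]
      by (simp add: J_def at_within_Icc_at)
    have "((\<lambda>z. J z - J (z - 1)) has_real_derivative \<sigma> y - \<sigma> (y - 1)) (at y)"
      using J[of y] J[of "y - 1"] DERIV_shift[of J "\<sigma> (y - 1)" y "-1"]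
      by (auto intro!: derivative_intros)
    moreover have "J z - J (z - 1) = F z" if "z \<in> {y - 1<..<y + 1}" for z
      unfolding J_def F_def
      using Henstock_Kurzweil_Integration.integral_combine[of "y - 3" "z - 1" z \<sigma>] int that by auto
    ultimately show ?thesis
      using has_field_derivative_transform_within_open[of "\<lambda>z. J z - J (z - 1)" _ y "{y - 1<..<y + 1}" F]
      by auto
  qed
  have F01: "0 \<le> F y" "F y \<le> 1" for y
  proof -
    show "0 \<le> F y" unfolding F_def using int r by (intro integral_nonneg) auto
    show "F y \<le> 1" unfolding F_def using integral_le[of \<sigma> "{y - 1..y}" "\<lambda>_. 1"] int r by auto
  qed
  have "derivs_bounded p (2 ^ Suc p) 1 (\<lambda>y. \<sigma> y - \<sigma> (y - 1))"
    using derivs_bounded_diff[OF sm, of "2 ^ p" "\<lambda>y. \<sigma> (y - 1)"] derivs_bounded_affine[OF sm, of 1 "-1"]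
    by (simp add: add.commute)
  hence "derivs_bounded (Suc p) (2 ^ Suc p) 1 F"
    using der F01 order_trans[OF F01(2) one_le_power[of "2::real" "Suc p"]]
    by (intro derivs_bounded_SucI) auto
  moreover have "F y = 0" if "y \<le> 0" for y
    unfolding F_def using that 0 by (subst integral_cong[of _ _ "\<lambda>_. 0"]) auto
  moreover have "F y = 1" if "y \<ge> real (Suc p) + 1" for y
    unfolding F_def using that 1 by (subst integral_cong[of _ _ "\<lambda>_. 1"]) auto
  moreover have "continuous_on UNIV F"
    using der DERIV_isCont by (blast intro: continuous_at_imp_continuous_on)
  ultimately show ?case using F01 by blast
qed

section \<open>Lattice points in boxes\<close>

lemma half_open_box_subset:
  "box u v \<subseteq> half_open_box u v" "half_open_box u v \<subseteq> cbox u (v :: real ^ 'd)"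
  by (auto simp: half_open_box_def mem_box_cart less_imp_le)

lemma bounded_half_open_box: "bounded (half_open_box u (v :: real ^ 'd))"
  by (rule bounded_subset[OF bounded_cbox half_open_box_subset(2)])

lemma half_open_box_borel: "half_open_box u (v :: real ^ 'd) \<in> sets borel"
proof -
  have "half_open_box u v = (\<Inter>j. {x. u $ j \<le> x $ j} \<inter> {x. x $ j < v $ j})"
    by (auto simp: half_open_box_def)
  also have "\<dots> \<in> sets borel"
    by (intro sets.countable_INT' sets.Int borel_closed borel_open closed_Collect_le open_Collect_less
        continuous_intros) auto
  finally show ?thesis .
qed

lemma measure_half_open_box:
  fixes u v :: "real ^ 'd"
  assumes "\<And>j. u $ j \<le> v $ j"
  shows "half_open_box u v \<in> lmeasurable"
    and "measure lebesgue (half_open_box u v) = (\<Prod>j\<in>UNIV. v $ j - u $ j)"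
proof -
  show lm: "half_open_box u v \<in> lmeasurable"
    by (intro bounded_set_imp_lmeasurable bounded_half_open_box) (simp add: half_open_box_borel)
  have "measure lebesgue (box u v) \<le> measure lebesgue (half_open_box u v)"
    using lm by (intro measure_mono_fmeasurable half_open_box_subset) auto
  moreover have "measure lebesgue (half_open_box u v) \<le> measure lebesgue (cbox u v)"
    using lm by (intro measure_mono_fmeasurable half_open_box_subset) (auto simp: fmeasurableD)
  moreover have "measure lebesgue (cbox u v) = (\<Prod>j\<in>UNIV. v $ j - u $ j)"
    using assms by (simp add: content_cbox_cart interval_ne_empty_cart)
  moreover have "measure lebesgue (box u v) = measure lebesgue (cbox u v)"
    by (simp add: measure_lborel_box_eq measure_lborel_cbox_eq)
  ultimately show "measure lebesgue (half_open_box u v) = (\<Prod>j\<in>UNIV. v $ j - u $ j)"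
    by linarith
qed

locale admissible_lattice =
  fixes T :: "real ^ 'd ^ 'd"
  assumes invertible: "invertible T" and admissible: "admissible (lattice_of T)"
begin

abbreviation X :: "(real ^ 'd) set" where
  "X \<equiv> lattice_of T"

lemma X_diff: "x \<in> X \<Longrightarrow> y \<in> X \<Longrightarrow> x - y \<in> X"
proof -
  assume "x \<in> X" "y \<in> X"
  then obtain k l :: "int ^ 'd" where "x = T *v (\<chi> j. of_int (k $ j))" "y = T *v (\<chi> j. of_int (l $ j))"
    by (auto simp: lattice_of_def)
  hence "x - y = T *v (\<chi> j. of_int ((k - l) $ j))"
    by (simp add: matrix_vector_mult_def vec_eq_iff sum_subtractf right_diff_distrib)
  thus ?thesis unfolding lattice_of_def by (rule range_eqI)
qed

lemma X_0: "0 \<in> X"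
proof -
  have "0 = T *v (\<chi> j. of_int ((0 :: int ^ 'd) $ j))"
    by (simp add: matrix_vector_mult_def vec_eq_iff)
  thus ?thesis unfolding lattice_of_def by blast
qed

lemma X_add: "x \<in> X \<Longrightarrow> y \<in> X \<Longrightarrow> x + y \<in> X"
  using X_diff[of x "0 - y"] X_diff[OF X_0, of y] by simp

text \<open>The norm minimum of the lattice; a volume divided by it bounds a number of lattice
  points.\<close>

definition nm :: real where
  "nm = (INF x\<in>X - {0}. \<Prod>j\<in>UNIV. \<bar>x $ j\<bar>)"

lemma nm_pos: "0 < nm"
  using admissible by (simp add: nm_def admissible_def)

lemma nm_le: "x \<in> X \<Longrightarrow> x \<noteq> 0 \<Longrightarrow> nm \<le> (\<Prod>j\<in>UNIV. \<bar>x $ j\<bar>)"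
  unfolding nm_def by (intro cINF_lower bdd_belowI[of _ 0]) (auto intro: prod_nonneg)

text \<open>Cutting one side of the box into more than vol / nm pieces leaves at most one lattice point
  in each piece.\<close>

lemma lattice_box_count:
  assumes "Z \<subseteq> X" "\<And>x j. x \<in> Z \<Longrightarrow> u j \<le> x $ j \<and> x $ j < u j + h j"
    and h: "\<And>j. 0 < h j"
  shows "finite Z" "real (card Z) \<le> (\<Prod>j\<in>UNIV. h j) / nm + 1"
proof -
  define v where "v = (\<Prod>j\<in>UNIV. h j)"
  \<comment> \<open>One more than the integer part, so that \<open>v / m < nm\<close> holds
    strictly.\<close>
  define m where "m = nat \<lfloor>v / nm\<rfloor> + 1"
  have v: "0 < v" unfolding v_def using h by (intro prod_pos) auto
  have "0 \<le> v / nm" using v nm_pos by simp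
  hence m: "real m > v / nm" "real m \<le> v / nm + 1" "m > 0" unfolding m_def by linarith+
  obtain e :: 'd where True by blast
  define f where "f x = nat \<lfloor>(x $ e - u e) * m / h e\<rfloor>" for x :: "real ^ 'd"
  have "f x < m" if "x \<in> Z" for x
  proof -
    have "(x $ e - u e) * m < h e * m"
      using assms(2)[OF that, of e] m by (intro mult_strict_right_mono) auto
    hence "(x $ e - u e) * m / h e < m" using h[of e] by (simp add: field_simps)
    moreover have "0 \<le> (x $ e - u e) * m / h e" using assms(2)[OF that, of e] h[of e] by simp
    ultimately show ?thesis unfolding f_def by linarith
  qed
  hence f: "f ` Z \<subseteq> {..<m}" by auto
  have "x = y" if xy: "x \<in> Z" "y \<in> Z" "f x = f y" for x y
  proof (rule ccontr)
    assume "x \<noteq> y"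
    have "0 \<le> (x $ e - u e) * m / h e" "0 \<le> (y $ e - u e) * m / h e"
      using assms(2)[OF xy(1), of e] assms(2)[OF xy(2), of e] h[of e] by auto
    hence "\<bar>(x $ e - u e) * m / h e - (y $ e - u e) * m / h e\<bar> \<le> 1"
      using xy(3) unfolding f_def by linarith
    also have "(x $ e - u e) * m / h e - (y $ e - u e) * m / h e = (x $ e - y $ e) * (m / h e)"
      by (simp add: left_diff_distrib[of "x $ e - u e" "y $ e - u e", symmetric]
          flip: diff_divide_distrib)
    finally have e: "\<bar>x $ e - y $ e\<bar> \<le> h e / m"
      using h[of e] m(3) by (simp add: abs_mult pos_le_divide_eq)
    \<comment> \<open>Two points in one slice differ by at most \<open>h e / m\<close> in coordinate
      \<open>e\<close> and by at most the side length elsewhere, so the product of their differences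
      is too small for a nonzero lattice vector.\<close>
    have "nm \<le> (\<Prod>j\<in>UNIV. \<bar>(x - y) $ j\<bar>)"
      using assms(1) xy \<open>x \<noteq> y\<close> by (intro nm_le X_diff) auto
    also have "\<dots> = \<bar>x $ e - y $ e\<bar> * (\<Prod>j\<in>UNIV - {e}. \<bar>(x - y) $ j\<bar>)"
      by (subst prod.remove[of _ e]) auto
    also have "\<dots> \<le> h e / m * (\<Prod>j\<in>UNIV - {e}. h j)"
    proof (intro mult_mono e prod_mono)
      show "0 \<le> \<bar>(x - y) $ j\<bar> \<and> \<bar>(x - y) $ j\<bar> \<le> h j" for j
        using assms(2)[OF xy(1), of j] assms(2)[OF xy(2), of j] by auto
    qed (use h[of e] in \<open>auto intro: prod_nonneg\<close>)
    also have "\<dots> = v / m"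
      unfolding v_def by (subst (2) prod.remove[of _ e]) auto
    also have "\<dots> < nm" using m v nm_pos by (simp add: field_simps)
    finally show False by simp
  qed
  hence inj: "inj_on f Z" by (auto intro: inj_onI)
  show "finite Z" using inj f finite_imageD finite_subset finite_lessThan by metis
  have "card Z \<le> m" using card_inj_on_le[OF inj f] by simp
  thus "real (card Z) \<le> (\<Prod>j\<in>UNIV. h j) / nm + 1" using m by (simp add: v_def)
qed

lemma finite_lattice_bounded:
  assumes "bounded B"
  shows "finite (X \<inter> B)"
proof -
  obtain R where R: "\<And>x. x \<in> B \<Longrightarrow> norm x \<le> R" "R > 0" using assms bounded_pos by metis
  have "\<bar>x $ j\<bar> \<le> R" if "x \<in> B" for x j using R(1)[OF that] component_le_norm_cart[of x j] by linarith
  hence "- R \<le> x $ j \<and> x $ j < - R + (2 * R + 1)" if "x \<in> B" for x j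
    using that by (smt (verit))
  then show ?thesis
    using lattice_box_count(1)[of "X \<inter> B" "\<lambda>_. - R" "\<lambda>_. 2 * R + 1"] R(2) by auto
qed

text \<open>The fundamental parallelepiped, half-open so that its lattice translates tile without
  overlap. As a preimage under a continuous map it is visibly Borel.\<close>

definition cell :: "(real ^ 'd) set" where
  "cell = {z. matrix_inv T *v z \<in> half_open_box 0 1}"

text \<open>This is the absolute determinant of \<open>T\<close>; taken as a measure it enters the
  averaging argument directly.\<close>

definition covol :: real where
  "covol = measure lebesgue cell"

lemma T_inv: "matrix_inv T *v (T *v z) = z" "T *v (matrix_inv T *v z) = z"
proof -
  have "T ** matrix_inv T = mat 1 \<and> matrix_inv T ** T = mat 1"
    unfolding matrix_inv_def using invertible[unfolded invertible_def] by (rule someI_ex)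
  thus "matrix_inv T *v (T *v z) = z" "T *v (matrix_inv T *v z) = z"
    by (simp_all add: matrix_vector_mul_assoc)
qed

lemma cell_eq: "cell = (\<lambda>z. T *v z) ` half_open_box 0 1"
  unfolding cell_def using T_inv by (auto simp: image_iff) metis

lemma cell_abs_le: "z \<in> cell \<Longrightarrow> \<bar>z $ j\<bar> \<le> (\<Sum>i\<in>UNIV. \<bar>T $ j $ i\<bar>)"
proof -
  assume "z \<in> cell"
  then obtain y where y: "z = T *v y" "\<And>i. 0 \<le> y $ i" "\<And>i. y $ i < 1"
    by (auto simp: cell_eq half_open_box_def)
  have "\<bar>z $ j\<bar> \<le> (\<Sum>i\<in>UNIV. \<bar>T $ j $ i * y $ i\<bar>)"
    by (simp add: y(1) matrix_vector_mult_def)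
  also have "\<dots> \<le> (\<Sum>i\<in>UNIV. \<bar>T $ j $ i\<bar>)"
    using y(2,3) by (intro sum_mono) (auto simp: abs_mult less_imp_le intro!: mult_left_le)
  finally show ?thesis .
qed

lemma bounded_cell: "bounded cell"
  unfolding cell_eq using bounded_half_open_box
  by (intro bounded_linear_image) (auto simp: linear_linear)

lemma cell_lmeasurable: "cell \<in> lmeasurable"
proof -
  have "(\<lambda>z. matrix_inv T *v z) -` half_open_box 0 1 \<inter> space borel \<in> sets borel"
    by (intro measurable_sets[OF borel_measurable_continuous_onI] half_open_box_borel
        linear_continuous_on) (simp add: linear_linear)
  hence "cell \<in> sets borel" by (simp add: cell_def vimage_def)
  thus ?thesis using bounded_cell by (intro bounded_set_imp_lmeasurable) simp_all
qed

lemma covol_pos: "0 < covol"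
proof -
  have c: "continuous_on UNIV (\<lambda>z. matrix_inv T *v z)" by (intro linear_continuous_on) (auto simp: linear_linear)
  define U where "U = (\<lambda>z. matrix_inv T *v z) -` box 0 1"
  have "open U" unfolding U_def using c open_vimage open_box by blast
  moreover have "T *v (\<chi> j. 1 / 2) \<in> U" by (simp add: U_def T_inv mem_box_cart)
  moreover have "U \<subseteq> cell" 
    using half_open_box_subset(1)[of 0 "1 :: real ^ 'd"] by (auto simp: U_def cell_def)
  ultimately have "\<not> negligible cell" using open_not_negligible negligible_subset by blast
  thus ?thesis using cell_lmeasurable by (simp add: covol_def negligible_iff_measure0 zero_less_measure_iff)
qed

text \<open>In the coordinates given by \<open>T\<close> the lattice is the integer lattice, and the
  lattice point sought is the coordinatewise floor.\<close>

lemma cell_tiling: "\<exists>!x. x \<in> X \<and> y - x \<in> cell"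
proof -
  define x where "x = T *v (\<chi> j. of_int ((\<chi> j. \<lfloor>(matrix_inv T *v y) $ j\<rfloor>) $ j))"
  show ?thesis
  proof (rule ex1I[of _ x], intro conjI)
    show "x \<in> X" unfolding x_def lattice_of_def by blast
    show "y - x \<in> cell"
      by (simp add: cell_def x_def matrix_vector_mult_diff_distrib T_inv half_open_box_def) linarith
  next
    fix x' assume x': "x' \<in> X \<and> y - x' \<in> cell"
    then obtain k :: "int ^ 'd" where k: "x' = T *v (\<chi> j. of_int (k $ j))" by (auto simp: lattice_of_def)
    have "k $ j = \<lfloor>(matrix_inv T *v y) $ j\<rfloor>" for j
    proof -
      have "0 \<le> (matrix_inv T *v y) $ j - of_int (k $ j)" "(matrix_inv T *v y) $ j - of_int (k $ j) < 1"
        using x' by (auto simp: k cell_def matrix_vector_mult_diff_distrib T_inv half_open_box_def)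
      thus ?thesis by linarith
    qed
    thus "x' = x" by (simp add: k x_def)
  qed
qed

text \<open>Integrate the count over one cell: the translates of the cell by \<open>X\<close> tile \<open>B\<close>.\<close>

lemma average_count:
  assumes B: "bounded B" "B \<in> sets lebesgue"
  shows "(\<And>\<delta>. l \<le> real (card {x \<in> X. x + \<delta> \<in> B})) \<Longrightarrow> l * covol \<le> measure lebesgue B"
    and "(\<And>\<delta>. real (card {x \<in> X. x + \<delta> \<in> B}) \<le> l) \<Longrightarrow> measure lebesgue B \<le> l * covol"
proof -
  \<comment> \<open>All lattice points that some shift from the cell can carry into
    \<open>B\<close>. A finite index set common to all shifts permits exchanging sum and
    integral.\<close>
  define Y where "Y = X \<inter> (\<Union>b\<in>B. \<Union>z\<in>cell. {b - z})"
  have finY: "finite Y" unfolding Y_def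
    by (intro finite_lattice_bounded bounded_differences B bounded_cell)
  \<comment> \<open>The shifts in the cell that carry \<open>x\<close> into \<open>B\<close>.
    Translated by \<open>x\<close> this is the part of \<open>B\<close> inside the tile at
    \<open>x\<close>, so the measures add up to that of \<open>B\<close>.\<close>
  define S where "S x = {z \<in> cell. x + z \<in> B}" for x
  have Bl: "B \<in> lmeasurable" using B by (rule bounded_set_imp_lmeasurable)
  have tr: "(+) x ` cell \<in> lmeasurable" for x using cell_lmeasurable by (rule measurable_translation)
  have ind: "integrable lebesgue (indicat_real A)" if "A \<in> lmeasurable" for A :: "(real ^ 'd) set"
    using that by (intro integrable_real_indicator) (auto simp: fmeasurable_def infinity_ennreal_def)
  have "S x = (+) (- x) ` (B \<inter> (+) x ` cell)" for x
  proof (intro equalityI subsetI)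
    fix z assume "z \<in> S x"
    hence "x + z \<in> B \<inter> (+) x ` cell" "z = - x + (x + z)" by (auto simp: S_def)
    thus "z \<in> (+) (- x) ` (B \<inter> (+) x ` cell)" by (rule rev_image_eqI)
  qed (auto simp: S_def)
  hence S: "S x \<in> lmeasurable" "measure lebesgue (S x) = measure lebesgue (B \<inter> (+) x ` cell)" for x
    by (simp_all only: measure_translation measurable_translation[OF fmeasurable.Int[OF Bl tr]])
  have "B = (\<Union>x\<in>Y. B \<inter> (+) x ` cell)"
  proof (intro equalityI subsetI)
    fix b assume b: "b \<in> B"
    obtain x where x: "x \<in> X" "b - x \<in> cell" using cell_tiling[of b] by blast
    have "x = b - (b - x)" by simp
    hence "x \<in> Y" unfolding Y_def using x b by blast
    moreover have "b \<in> (+) x ` cell" using x by (auto simp: image_iff intro: bexI[of _ "b - x"])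
    ultimately show "b \<in> (\<Union>x\<in>Y. B \<inter> (+) x ` cell)" using b by blast
  qed auto
  hence "measure lebesgue B = measure lebesgue (\<Union>x\<in>Y. B \<inter> (+) x ` cell)" by simp
  also have "\<dots> = (\<Sum>x\<in>Y. measure lebesgue (B \<inter> (+) x ` cell))"
  proof (rule measure_UNION')
    show "pairwise (\<lambda>x y. disjnt (B \<inter> (+) x ` cell) (B \<inter> (+) y ` cell)) Y"
    proof (intro pairwiseI)
      fix x y assume xy: "x \<in> Y" "y \<in> Y" "x \<noteq> y"
      have False if "b \<in> (+) x ` cell" "b \<in> (+) y ` cell" for b
      proof -
        have "b - x \<in> cell" if "b \<in> (+) x ` cell" for x using that by auto
        from this[OF that(1)] this[OF that(2)] show False using xy cell_tiling[of b] by (auto simp only: Y_def)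
      qed
      thus "disjnt (B \<inter> (+) x ` cell) (B \<inter> (+) y ` cell)" by (auto simp: disjnt_def)
    qed
  qed (use finY Bl tr in auto)
  also have "\<dots> = (\<Sum>x\<in>Y. integral\<^sup>L lebesgue (indicat_real (S x)))"
    using S by simp
  also have "\<dots> = integral\<^sup>L lebesgue (\<lambda>z. \<Sum>x\<in>Y. indicat_real (S x) z)"
    using S ind by (intro Bochner_Integration.integral_sum[symmetric]) auto
  finally have meas: "measure lebesgue B = integral\<^sup>L lebesgue (\<lambda>z. \<Sum>x\<in>Y. indicat_real (S x) z)" .
  have count: "(\<Sum>x\<in>Y. indicat_real (S x) z) = indicat_real cell z * real (card {x \<in> X. x + z \<in> B})" for z
  proof (cases "z \<in> cell")
    case True
    have "x \<in> Y" if "x \<in> X" "x + z \<in> B" for x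
    proof -
      have "x = (x + z) - z" by simp
      thus ?thesis using that True unfolding Y_def by blast
    qed
    hence "Y \<inter> {x. z \<in> S x} = {x \<in> X. x + z \<in> B}"
      using True by (auto simp: S_def Y_def)
    moreover have "(\<Sum>x\<in>Y. indicat_real (S x) z) = real (card (Y \<inter> {x. z \<in> S x}))"
      using finY by (simp add: indicator_def sum.If_cases)
    ultimately show ?thesis using True by simp
  qed (auto simp: S_def)
  have int: "integrable lebesgue (\<lambda>z. \<Sum>x\<in>Y. indicat_real (S x) z)"
    using S ind by (intro Bochner_Integration.integrable_sum) auto
  have lint: "integrable lebesgue (\<lambda>z. l * indicat_real cell z)"
    "integral\<^sup>L lebesgue (\<lambda>z. l * indicat_real cell z) = l * covol"
    using ind[OF cell_lmeasurable] by (auto simp: covol_def)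
  show "l * covol \<le> measure lebesgue B" if "\<And>\<delta>. l \<le> real (card {x \<in> X. x + \<delta> \<in> B})"
    unfolding meas lint(2)[symmetric]
    by (intro integral_mono lint int) (use that in \<open>simp add: count split: split_indicator\<close>)
  show "measure lebesgue B \<le> l * covol" if "\<And>\<delta>. real (card {x \<in> X. x + \<delta> \<in> B}) \<le> l"
    unfolding meas lint(2)[symmetric]
    by (intro integral_mono lint int) (use that in \<open>simp add: count split: split_indicator\<close>)
qed

text \<open>Blichfeldt's argument: a half-open box of volume above \<open>covol\<close> contains
  more than one lattice point on average, so some translate contains two, and their difference is
  the vector.\<close>

lemma lattice_vector_in_box:
  assumes h: "\<And>j. 0 < h j" and vol: "covol < (\<Prod>j\<in>UNIV. h j)"
  shows "\<exists>w\<in>X - {0}. \<forall>j. \<bar>w $ j\<bar> < h j"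
proof (rule ccontr)
  assume none: "\<not> ?thesis"
  define B where "B = half_open_box 0 (\<chi> j. h j)"
  have B: "B \<in> lmeasurable" "measure lebesgue B = (\<Prod>j\<in>UNIV. h j)"
    using measure_half_open_box[of 0 "\<chi> j. h j"] h by (auto simp: B_def less_imp_le)
  have "real (card {x \<in> X. x + \<delta> \<in> B}) \<le> 1" for \<delta>
  proof -
    have "x = y" if "x \<in> X" "x + \<delta> \<in> B" "y \<in> X" "y + \<delta> \<in> B" for x y
    proof (rule ccontr)
      assume "x \<noteq> y"
      have "\<bar>(x - y) $ j\<bar> < h j" for j
      proof -
        have "0 \<le> (x + \<delta>) $ j" "(x + \<delta>) $ j < h j" "0 \<le> (y + \<delta>) $ j" "(y + \<delta>) $ j < h j"
          using that by (auto simp: B_def half_open_box_def)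
        thus ?thesis by simp
      qed
      moreover have "x - y \<in> X - {0}" using that \<open>x \<noteq> y\<close> X_diff by simp
      ultimately show False using none by blast
    qed
    hence "\<exists>y. {x \<in> X. x + \<delta> \<in> B} \<subseteq> {y}" by blast
    then obtain y where "{x \<in> X. x + \<delta> \<in> B} \<subseteq> {y}" by blast
    from card_mono[OF _ this] show ?thesis by simp
  qed
  moreover have "bounded B" unfolding B_def by (rule bounded_half_open_box)
  ultimately have "(\<Prod>j\<in>UNIV. h j) \<le> 1 * covol"
    using B average_count(2)[of B 1] by (simp add: fmeasurableD)
  with vol show False by simp
qed

end

section \<open>Lattice sums and short vectors\<close>

definition box_supported :: "(real ^ 'd \<Rightarrow> real) \<Rightarrow> ('d \<Rightarrow> real) \<Rightarrow> ('d \<Rightarrow> real) \<Rightarrow> bool" where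
  "box_supported G u h \<longleftrightarrow> (\<forall>x. G x \<noteq> 0 \<longrightarrow> (\<forall>j. u j \<le> x $ j \<and> x $ j < u j + h j))"

text \<open>In the row of a largest coordinate of a kernel vector the diagonal term outweighs all
  others unless that coordinate is 0. The bound \<open>c\<close> depends on the row because in the
  application row \<open>j\<close> scales with \<open>s j\<close>.\<close>

lemma diagonally_dominant_surj:
  fixes M :: "real ^ 'n ^ 'n" and c :: "'n \<Rightarrow> real"
  assumes off: "\<And>i j. i \<noteq> j \<Longrightarrow> \<bar>M $ j $ i\<bar> \<le> c j"
    and diag: "\<And>j. CARD('n) * c j < \<bar>M $ j $ j\<bar>" and c: "\<And>j. 0 \<le> c j"
  shows "surj (\<lambda>t. M *v t)"
proof -
  have "t = 0" if t: "M *v t = 0" for t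
  proof -
    have "Max (range (\<lambda>i. \<bar>t $ i\<bar>)) \<in> range (\<lambda>i. \<bar>t $ i\<bar>)" by (intro Max_in) auto
    then obtain j where "Max (range (\<lambda>i. \<bar>t $ i\<bar>)) = \<bar>t $ j\<bar>" by (rule imageE)
    moreover have "\<bar>t $ i\<bar> \<le> Max (range (\<lambda>i. \<bar>t $ i\<bar>))" for i by (intro Max_ge) auto
    ultimately have j: "\<bar>t $ i\<bar> \<le> \<bar>t $ j\<bar>" for i by simp
    have "0 = (M *v t) $ j" using t by simp
    also have "\<dots> = (\<Sum>i\<in>UNIV. M $ j $ i * t $ i)" by (simp add: matrix_vector_mult_def)
    also have "\<dots> = M $ j $ j * t $ j + (\<Sum>i\<in>UNIV - {j}. M $ j $ i * t $ i)"
      by (subst sum.remove[of _ j]) auto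
    finally have eq: "M $ j $ j * t $ j = - (\<Sum>i\<in>UNIV - {j}. M $ j $ i * t $ i)" by linarith
    have "\<bar>M $ j $ j\<bar> * \<bar>t $ j\<bar> = \<bar>\<Sum>i\<in>UNIV - {j}. M $ j $ i * t $ i\<bar>"
      by (simp only: abs_mult[symmetric] eq abs_minus_cancel)
    also have "\<dots> \<le> (\<Sum>i\<in>UNIV - {j}. c j * \<bar>t $ j\<bar>)"
    proof (intro order_trans[OF sum_abs] sum_mono)
      fix i assume "i \<in> UNIV - {j}"
      thus "\<bar>M $ j $ i * t $ i\<bar> \<le> c j * \<bar>t $ j\<bar>"
        using off[of i j] j[of i] c[of j] unfolding abs_mult by (intro mult_mono) auto
    qed
    also have "\<dots> = real (CARD('n) - 1) * (c j * \<bar>t $ j\<bar>)" by (simp add: card_Diff_singleton)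
    also have "\<dots> \<le> CARD('n) * (c j * \<bar>t $ j\<bar>)"
      using c[of j] by (intro mult_right_mono) auto
    finally have "\<bar>M $ j $ j\<bar> * \<bar>t $ j\<bar> \<le> (CARD('n) * c j) * \<bar>t $ j\<bar>" by (simp add: mult.assoc)
    hence "\<bar>t $ j\<bar> = 0" using diag[of j] mult_strict_right_mono[of "CARD('n) * c j" "\<bar>M $ j $ j\<bar>" "\<bar>t $ j\<bar>"]
      by (cases "\<bar>t $ j\<bar> = 0") auto
    thus ?thesis using j by (simp add: vec_eq_iff)
  qed
  hence "\<exists>B. B ** M = mat 1" by (simp add: matrix_left_invertible_ker)
  hence "\<exists>B. M ** B = mat 1" using matrix_left_right_inverse[of _ M] by auto
  thus ?thesis by (simp add: matrix_right_invertible_surjective)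
qed

context admissible_lattice
begin

text \<open>Points outside \<open>X\<close> receive the term 0, so that the index type is the whole
  space and \<open>derivs_bounded_fsum\<close> applies.\<close>

definition lsum :: "(real ^ 'd \<Rightarrow> real) \<Rightarrow> real ^ 'd \<Rightarrow> real" where
  "lsum G \<delta> = fsum (\<lambda>x. if x \<in> X then G (x + \<delta>) else 0)"

text \<open>Finiteness is included because \<open>fsum\<close> is additive only on finitely supported families.\<close>

definition osc_le :: "(real ^ 'd \<Rightarrow> real) \<Rightarrow> real \<Rightarrow> bool" where
  "osc_le G E \<longleftrightarrow> (\<forall>\<delta>. finite {x \<in> X. G (x + \<delta>) \<noteq> 0}) \<and>
    (\<forall>\<delta> \<delta>'. \<bar>lsum G \<delta> - lsum G \<delta>'\<bar> \<le> E)"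

lemma osc_le_mono: "osc_le G E \<Longrightarrow> E \<le> E' \<Longrightarrow> osc_le G E'"
  unfolding osc_le_def using order_trans by blast

lemma lsum_eq:
  assumes "finite Y" "Y \<subseteq> X" "{x \<in> X. G (x + \<delta>) \<noteq> 0} \<subseteq> Y"
  shows "lsum G \<delta> = (\<Sum>x\<in>Y. G (x + \<delta>))"
proof -
  have "lsum G \<delta> = (\<Sum>x\<in>Y. if x \<in> X then G (x + \<delta>) else 0)"
    unfolding lsum_def using assms by (intro fsum_eq) auto
  also have "\<dots> = (\<Sum>x\<in>Y. G (x + \<delta>))" using assms by (intro sum.cong) auto
  finally show ?thesis .
qed

lemma box_supported_count:
  assumes "box_supported G u h" "\<And>j. 0 < h j"
  shows "finite {x \<in> X. G (x + \<delta>) \<noteq> 0}"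
    and "real (card {x \<in> X. G (x + \<delta>) \<noteq> 0}) \<le> (\<Prod>j\<in>UNIV. h j) / nm + 1"
proof -
  define Z where "Z = {x \<in> X. G (x + \<delta>) \<noteq> 0}"
  have "u j - \<delta> $ j \<le> x $ j \<and> x $ j < u j - \<delta> $ j + h j" if "x \<in> Z" for x j
  proof -
    have "u j \<le> (x + \<delta>) $ j \<and> (x + \<delta>) $ j < u j + h j"
      using that assms(1) unfolding box_supported_def Z_def by blast
    thus ?thesis by simp
  qed
  moreover have "Z \<subseteq> X" by (auto simp: Z_def)
  ultimately show "finite {x \<in> X. G (x + \<delta>) \<noteq> 0}"
    "real (card {x \<in> X. G (x + \<delta>) \<noteq> 0}) \<le> (\<Prod>j\<in>UNIV. h j) / nm + 1"
    unfolding Z_def[symmetric]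
    using lattice_box_count[of Z "\<lambda>j. u j - \<delta> $ j" h] assms(2) by blast+
qed

text \<open>Translation by a lattice vector only permutes the lattice. This is the source of all
  periodicity below.\<close>

lemma lsum_shift:
  assumes "w \<in> X"
  shows "lsum G (\<delta> + w) = lsum G \<delta>"
  unfolding lsum_def fsum_def
proof (rule sum.reindex_bij_witness[of _ "\<lambda>x. x - w" "\<lambda>x. x + w"])
  have eq: "x + (\<delta> + w) = x + w + \<delta>" "x - w + (\<delta> + w) = x + \<delta>" for x by simp_all
  fix x
  show "x + w \<in> {x. (if x \<in> X then G (x + \<delta>) else 0) \<noteq> 0}"
    "(if x + w \<in> X then G (x + w + \<delta>) else 0) = (if x \<in> X then G (x + (\<delta> + w)) else 0)"
    if "x \<in> {x. (if x \<in> X then G (x + (\<delta> + w)) else 0) \<noteq> 0}"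
    using that X_add[OF _ assms] by (auto simp: eq split: if_splits)
  show "x - w \<in> {x. (if x \<in> X then G (x + (\<delta> + w)) else 0) \<noteq> 0}"
    if "x \<in> {x. (if x \<in> X then G (x + \<delta>) else 0) \<noteq> 0}"
    using that X_diff[OF _ assms] by (auto simp: eq split: if_splits)
qed simp_all

text \<open>The trivial bound: number of terms times supremum, for each of the two translates. It
  serves the boxes of bounded volume, where smoothness gains nothing.\<close>

lemma osc_le_bounded:
  assumes "box_supported G u h" "\<And>j. 0 < h j" "\<And>x. \<bar>G x\<bar> \<le> K"
  shows "osc_le G (2 * (K * ((\<Prod>j\<in>UNIV. h j) / nm + 1)))"
proof -
  have K: "0 \<le> K" using assms(3)[of 0] by linarith
  have "\<bar>lsum G \<delta>\<bar> \<le> K * ((\<Prod>j\<in>UNIV. h j) / nm + 1)" for \<delta>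
  proof -
    have "\<bar>lsum G \<delta>\<bar> = \<bar>\<Sum>x\<in>{x \<in> X. G (x + \<delta>) \<noteq> 0}. G (x + \<delta>)\<bar>"
      using box_supported_count(1)[OF assms(1,2)] by (subst lsum_eq) auto
    also have "\<dots> \<le> (\<Sum>x\<in>{x \<in> X. G (x + \<delta>) \<noteq> 0}. K)"
      using assms(3) by (intro order_trans[OF sum_abs] sum_mono) auto
    also have "\<dots> = K * real (card {x \<in> X. G (x + \<delta>) \<noteq> 0})" by simp
    also have "\<dots> \<le> K * ((\<Prod>j\<in>UNIV. h j) / nm + 1)"
      using K box_supported_count(2)[OF assms(1,2)] by (intro mult_left_mono)
    finally show ?thesis .
  qed
  note bound = this
  have "\<bar>lsum G \<delta> - lsum G \<delta>'\<bar> \<le> 2 * (K * ((\<Prod>j\<in>UNIV. h j) / nm + 1))" for \<delta> \<delta>'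
    using bound[of \<delta>] bound[of \<delta>'] by linarith
  thus ?thesis using box_supported_count(1)[OF assms(1,2)] by (simp add: osc_le_def)
qed

text \<open>With \<open>c\<close> equal to 1 or -1 one rule covers the sums and the differences of
  the dyadic splitting.\<close>

lemma osc_le_add_mult:
  assumes "osc_le F E" "osc_le G E'" "\<bar>c\<bar> \<le> 1"
  shows "osc_le (\<lambda>x. F x + c * G x) (E + E')"
proof -
  have eq: "lsum (\<lambda>x. F x + c * G x) \<delta> = lsum F \<delta> + c * lsum G \<delta>" for \<delta>
  proof -
    define Y where "Y = {x \<in> X. F (x + \<delta>) \<noteq> 0} \<union> {x \<in> X. G (x + \<delta>) \<noteq> 0}"
    have "finite Y" "Y \<subseteq> X" using assms(1,2) by (auto simp: Y_def osc_le_def)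
    hence "lsum F \<delta> = (\<Sum>x\<in>Y. F (x + \<delta>))" "lsum G \<delta> = (\<Sum>x\<in>Y. G (x + \<delta>))"
      "lsum (\<lambda>x. F x + c * G x) \<delta> = (\<Sum>x\<in>Y. F (x + \<delta>) + c * G (x + \<delta>))"
      by (intro lsum_eq; auto simp: Y_def)+
    thus ?thesis by (simp add: sum.distrib sum_distrib_left)
  qed
  have "\<bar>lsum (\<lambda>x. F x + c * G x) \<delta> - lsum (\<lambda>x. F x + c * G x) \<delta>'\<bar> \<le> E + E'" for \<delta> \<delta>'
  proof -
    have "\<bar>c * (lsum G \<delta> - lsum G \<delta>')\<bar> \<le> 1 * \<bar>lsum G \<delta> - lsum G \<delta>'\<bar>"
      unfolding abs_mult using assms(3) by (intro mult_right_mono) auto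
    also have "\<dots> \<le> E'" using assms(2) by (simp add: osc_le_def)
    finally have "\<bar>(lsum F \<delta> - lsum F \<delta>') + c * (lsum G \<delta> - lsum G \<delta>')\<bar> \<le> E + E'"
      using assms(1) by (intro order_trans[OF abs_triangle_ineq] add_mono) (auto simp: osc_le_def)
    moreover have "lsum F \<delta> + c * lsum G \<delta> - (lsum F \<delta>' + c * lsum G \<delta>') =
        (lsum F \<delta> - lsum F \<delta>') + c * (lsum G \<delta> - lsum G \<delta>')" by (simp add: algebra_simps)
    ultimately show ?thesis unfolding eq by simp
  qed
  moreover have "finite {x \<in> X. F (x + \<delta>) + c * G (x + \<delta>) \<noteq> 0}" for \<delta>
    by (rule finite_subset[of _ "{x \<in> X. F (x + \<delta>) \<noteq> 0} \<union> {x \<in> X. G (x + \<delta>) \<noteq> 0}"])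
      (use assms(1,2) in \<open>auto simp: osc_le_def\<close>)
  ultimately show ?thesis by (simp add: osc_le_def)
qed

text \<open>For each coordinate \<open>i\<close> take a box that is long in direction \<open>i\<close> and thin in all others; by
  admissibility a lattice vector in it cannot be short in direction \<open>i\<close>. The resulting system is
  diagonally dominant.\<close>

lemma short_vectors:
  "\<exists>H>0. \<forall>s. (\<forall>j. 0 < s j) \<longrightarrow> (\<Prod>j\<in>UNIV. s j) = 1 \<longrightarrow>
    (\<exists>w :: 'd \<Rightarrow> real ^ 'd. (\<forall>i. w i \<in> X) \<and> (\<forall>i j. \<bar>w i $ j\<bar> \<le> H * s j) \<and> (\<forall>z. \<exists>t. z = (\<Sum>i\<in>UNIV. t i *\<^sub>R w i)))"
proof -
  let ?d = "CARD('d)"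
  \<comment> \<open>The thin relative width. The factor 2 in \<open>2 * ?d\<close> leaves room for
    strict diagonal dominance.\<close>
  define \<epsilon> where "\<epsilon> = min 1 (nm / (2 * ?d))"
  have \<epsilon>: "0 < \<epsilon>" "\<epsilon> \<le> 1" "2 * ?d * \<epsilon> \<le> nm"
    using nm_pos unfolding \<epsilon>_def by (auto simp: min_def field_simps)
  \<comment> \<open>The long relative side, chosen to give the box volume \<open>covol + 1\<close>,
    enough for \<open>lattice_vector_in_box\<close>.\<close>
  define L where "L = (covol + 1) / \<epsilon> ^ (?d - 1)"
  have L: "L > 0" using covol_pos \<epsilon> by (simp add: L_def)
  define H where "H = max L \<epsilon>"
  show ?thesis
  proof (intro exI[of _ H] conjI allI impI)
    show "H > 0" using L by (simp add: H_def)
    fix s :: "'d \<Rightarrow> real" assume s0: "\<forall>j. 0 < s j" and s1: "(\<Prod>j\<in>UNIV. s j) = 1"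
    have s: "0 < s j" for j using s0 by blast
    have "\<exists>w\<in>X - {0}. \<forall>j. \<bar>w $ j\<bar> < (if j = i then L else \<epsilon>) * s j" for i
    proof (rule lattice_vector_in_box)
      show "0 < (if j = i then L else \<epsilon>) * s j" for j using L \<epsilon> s by simp
      have "(\<Prod>j\<in>UNIV. (if j = i then L else \<epsilon>) * s j) = (\<Prod>j\<in>UNIV. if j = i then L else \<epsilon>)"
        using s1 by (simp add: prod.distrib)
      also have "\<dots> = L * (\<Prod>j\<in>UNIV - {i}. if j = i then L else \<epsilon>)"
        by (subst prod.remove[of _ i]) auto
      also have "(\<Prod>j\<in>UNIV - {i}. if j = i then L else \<epsilon>) = (\<Prod>j\<in>UNIV - {i}. \<epsilon>)"
        by (intro prod.cong) auto
      also have "L * \<dots> = covol + 1" using \<epsilon> by (simp add: L_def card_Diff_singleton)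
      finally show "covol < (\<Prod>j\<in>UNIV. (if j = i then L else \<epsilon>) * s j)" by simp
    qed
    hence "\<forall>i. \<exists>w. w \<in> X - {0} \<and> (\<forall>j. \<bar>w $ j\<bar> < (if j = i then L else \<epsilon>) * s j)" by blast
    from choice[OF this] obtain w
      where "\<And>i. w i \<in> X - {0} \<and> (\<forall>j. \<bar>w i $ j\<bar> < (if j = i then L else \<epsilon>) * s j)" by blast
    hence w: "w i \<in> X" "w i \<noteq> 0" "\<bar>w i $ j\<bar> < (if j = i then L else \<epsilon>) * s j" for i j by simp_all
    have wH: "\<bar>w i $ j\<bar> \<le> H * s j" for i j
    proof -
      have "(if j = i then L else \<epsilon>) * s j \<le> H * s j"
        using s[of j] by (intro mult_right_mono) (auto simp: H_def)
      thus ?thesis using w(3)[of i j] by linarith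
    qed
    \<comment> \<open>Since the other coordinates are at most \<open>s j\<close> in size and the
      \<open>s j\<close> multiply to 1, admissibility gives
      \<open>nm \<le> \<bar>w i $ i\<bar> / s i\<close>; compare with
      \<open>2 * ?d * \<epsilon> \<le> nm\<close>.\<close>
    have diag: "?d * (\<epsilon> * s i) < \<bar>w i $ i\<bar>" for i
    proof -
      have thin: "\<bar>w i $ j\<bar> \<le> \<epsilon> * s j" if "j \<noteq> i" for j using w(3)[of i j] that by simp
      have "nm \<le> (\<Prod>j\<in>UNIV. \<bar>w i $ j\<bar>)" using w by (intro nm_le) auto
      also have "\<dots> = \<bar>w i $ i\<bar> * (\<Prod>j\<in>UNIV - {i}. \<bar>w i $ j\<bar>)"
        by (subst prod.remove[of _ i]) auto
      also have "\<dots> \<le> \<bar>w i $ i\<bar> * (\<Prod>j\<in>UNIV - {i}. \<epsilon> * s j)"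
        using thin by (intro mult_left_mono prod_mono) auto
      also have "\<dots> \<le> \<bar>w i $ i\<bar> * (\<Prod>j\<in>UNIV - {i}. s j)"
        using s \<epsilon> by (intro mult_left_mono prod_mono) (auto intro: less_imp_le simp: mult_left_le_one_le)
      finally have "s i * nm \<le> s i * (\<bar>w i $ i\<bar> * (\<Prod>j\<in>UNIV - {i}. s j))"
        using s[of i] by (intro mult_left_mono) auto
      also have "\<dots> = \<bar>w i $ i\<bar> * (s i * (\<Prod>j\<in>UNIV - {i}. s j))" by (simp add: mult_ac)
      also have "s i * (\<Prod>j\<in>UNIV - {i}. s j) = 1" using s1 by (subst (asm) prod.remove[of _ i]) auto
      finally have "s i * nm \<le> \<bar>w i $ i\<bar>" by simp
      moreover have "s i * (2 * ?d * \<epsilon>) \<le> s i * nm" using s[of i] \<epsilon> by (intro mult_left_mono) auto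
      moreover have "?d * (\<epsilon> * s i) > 0" using s[of i] \<epsilon> by simp
      ultimately show ?thesis by (simp add: mult_ac)
    qed
    define M :: "real ^ 'd ^ 'd" where "M = (\<chi> j i. w i $ j)"
    have Mv: "M *v t = (\<Sum>i\<in>UNIV. t $ i *\<^sub>R w i)" for t
      by (simp add: vec_eq_iff M_def matrix_vector_mult_def mult.commute)
    have "surj (\<lambda>t. M *v t)"
    proof (rule diagonally_dominant_surj[where c = "\<lambda>j. \<epsilon> * s j"])
      show "\<bar>M $ j $ i\<bar> \<le> \<epsilon> * s j" if "i \<noteq> j" for i j
        using w(3)[of i j] that by (simp add: M_def)
      show "?d * (\<epsilon> * s j) < \<bar>M $ j $ j\<bar>" for j using diag by (simp add: M_def)
      show "0 \<le> \<epsilon> * s j" for j using s[of j] \<epsilon> by simp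
    qed
    hence "\<exists>t. z = (\<Sum>i\<in>UNIV. t i *\<^sub>R w i)" for z
      using Mv surjD[of "\<lambda>t. M *v t" z] by auto
    hence "(\<forall>i. w i \<in> X) \<and> (\<forall>i j. \<bar>w i $ j\<bar> \<le> H * s j) \<and>
        (\<forall>z. \<exists>t. z = (\<Sum>i\<in>UNIV. t i *\<^sub>R w i))"
      using w(1) wH by simp
    thus "\<exists>w :: 'd \<Rightarrow> real ^ 'd. (\<forall>i. w i \<in> X) \<and> (\<forall>i j. \<bar>w i $ j\<bar> \<le> H * s j) \<and>
        (\<forall>z. \<exists>t. z = (\<Sum>i\<in>UNIV. t i *\<^sub>R w i))"
      by - (rule exI[of _ w])
  qed
qed

end

section \<open>Dyadic decomposition of box indicators\<close>

text \<open>The profile \<open>g\<close> may vary, but \<open>K\<close> and the width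
  \<open>W\<close> relative to the scale \<open>h\<close> are common to all bumps. The frequency is
  2 and not 1 to accommodate the refinement profile
  \<open>\<sigma> (2 * z) - \<sigma> z\<close>.\<close>

definition bump :: "nat \<Rightarrow> real \<Rightarrow> real \<Rightarrow> real \<Rightarrow> (real \<Rightarrow> real) \<Rightarrow> bool" where
  "bump p K W h f \<longleftrightarrow> (\<exists>g u. derivs_bounded p K 2 g \<and> (\<forall>y. g y \<noteq> 0 \<longrightarrow> 0 \<le> y \<and> y < W) \<and>
    f = (\<lambda>y. g ((y - u) / h)))"

definition interval_supported :: "real \<Rightarrow> (real \<Rightarrow> real) \<Rightarrow> bool" where
  "interval_supported h f \<longleftrightarrow> (\<exists>u. \<forall>y. f y \<noteq> 0 \<longrightarrow> u \<le> y \<and> y < u + h)"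

lemma interval_supported_mono: "interval_supported h f \<Longrightarrow> h \<le> h' \<Longrightarrow> interval_supported h' f"
  unfolding interval_supported_def by (smt (verit))

lemma bump_abs_le: "bump p K W h f \<Longrightarrow> \<bar>f y\<bar> \<le> K"
  unfolding bump_def using derivs_bounded_abs_le by blast

lemma bump_interval_supported:
  assumes "bump p K W h f" "0 < h"
  shows "interval_supported (W * h) f"
proof -
  from assms(1) obtain g u where g: "\<And>y. g y \<noteq> 0 \<Longrightarrow> 0 \<le> y \<and> y < W" "f = (\<lambda>y. g ((y - u) / h))"
    unfolding bump_def by blast
  have "u \<le> y \<and> y < u + W * h" if "f y \<noteq> 0" for y
    using g(1)[of "(y - u) / h"] that assms(2) by (simp add: g(2) field_simps)
  thus ?thesis unfolding interval_supported_def by blast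
qed

lemma box_supported_prod:
  assumes "\<And>j. interval_supported (h j) (q j)"
  shows "\<exists>u. box_supported (\<lambda>x :: real ^ 'd. \<Prod>j\<in>UNIV. q j (x $ j)) u h"
proof -
  have "\<forall>j. \<exists>u. \<forall>y. q j y \<noteq> 0 \<longrightarrow> u \<le> y \<and> y < u + h j"
    using assms unfolding interval_supported_def by blast
  from choice[OF this] obtain u where u: "\<And>j y. q j y \<noteq> 0 \<Longrightarrow> u j \<le> y \<and> y < u j + h j" by blast
  have "box_supported (\<lambda>x :: real ^ 'd. \<Prod>j\<in>UNIV. q j (x $ j)) u h"
    unfolding box_supported_def
  proof (intro allI impI)
    fix x :: "real ^ 'd" and j assume "(\<Prod>j\<in>UNIV. q j (x $ j)) \<noteq> 0"
    hence "q j (x $ j) \<noteq> 0" by simp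
    thus "u j \<le> x $ j \<and> x $ j < u j + h j" by (rule u)
  qed
  thus ?thesis by blast
qed

text \<open>\<open>\<phi> l\<close> is the approximation at scale \<open>b / 2 ^ l\<close>. The
  clauses give its start, its refinement, and its distance from the indicator; the remainders are
  merely bounded, not smooth. The coefficients 1 and -1 are spelled out to match
  \<open>osc_le_add_mult\<close>.\<close>

definition dyadic_splitting :: "nat \<Rightarrow> real \<Rightarrow> real \<Rightarrow> bool" where
  "dyadic_splitting p K W \<longleftrightarrow> (\<forall>u b. 0 < b \<longrightarrow> (\<exists>\<phi>. bump p K W b (\<phi> 0) \<and>
    (\<forall>l. \<exists>f g. bump p K W (b / 2 ^ l) f \<and> bump p K W (b / 2 ^ l) g \<and>
      \<phi> (Suc l) = (\<lambda>y. (\<phi> l y + 1 * f y) + (- 1) * g y)) \<and>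
    (\<forall>l. \<exists>f g. (\<forall>y. \<bar>f y\<bar> \<le> 1) \<and> interval_supported (W * (b / 2 ^ l)) f \<and>
      (\<forall>y. \<bar>g y\<bar> \<le> 1) \<and> interval_supported (W * (b / 2 ^ l)) g \<and>
      indicat_real {u..<u + b} = (\<lambda>y. (\<phi> l y + 1 * f y) + (- 1) * g y))))"

text \<open>With \<open>\<sigma>\<close> a smooth step, the indicator of \<open>[u, u + b)\<close> is approximated at scale \<open>b / 2 ^ l\<close> by
  the difference of rescaled steps at its two endpoints; consecutive approximations differ by one bump
  at each endpoint.\<close>

lemma interval_decomposition:
  "\<exists>K W. 1 \<le> K \<and> 1 \<le> W \<and> dyadic_splitting p K W"
proof -
  obtain \<sigma> where sm: "derivs_bounded p (2 ^ p) 1 \<sigma>"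
    and 0: "\<And>y. y \<le> 0 \<Longrightarrow> \<sigma> y = 0" and 1: "\<And>y. y \<ge> real p + 1 \<Longrightarrow> \<sigma> y = 1"
    and r: "\<And>y. 0 \<le> \<sigma> y" "\<And>y. \<sigma> y \<le> 1"
    using smooth_step_exists[of p] by blast
  \<comment> \<open>Every profile is a difference of two steps, each bounded by
    \<open>2 ^ p\<close>.\<close>
  define K :: real where "K = 2 ^ p + 2 ^ p"
  \<comment> \<open>The step is constant outside \<open>[0, p + 1]\<close> and the translated one
    outside \<open>[1, p + 2]\<close>; one unit is to spare for the strict bound.\<close>
  define W where "W = real p + 3"
  have sm2: "derivs_bounded p (2 ^ p) 2 \<sigma>" by (rule derivs_bounded_mono[OF sm]) auto
  show ?thesis
    unfolding dyadic_splitting_def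
  proof (rule exI[of _ K], rule exI[of _ W], intro conjI allI impI)
    show "1 \<le> K" using one_le_power[of "2::real" p] unfolding K_def by linarith
    show "1 \<le> W" by (simp add: W_def)
    fix u b :: real assume b: "0 < b"
    \<comment> \<open>At \<open>l = 0\<close> the two endpoints are one unit of scale apart, so the
      whole difference is a single bump.\<close>
    define \<phi> where "\<phi> l y = \<sigma> ((y - u) / (b / 2 ^ l)) - \<sigma> ((y - (u + b)) / (b / 2 ^ l))" for l :: nat and y
    have g0: "bump p K W b (\<phi> 0)"
      unfolding bump_def
    proof (intro exI[of _ "\<lambda>z. \<sigma> z - \<sigma> (z - 1)"] exI[of _ u] conjI allI impI)
      show "derivs_bounded p K 2 (\<lambda>z. \<sigma> z - \<sigma> (z - 1))"
        unfolding K_def using derivs_bounded_affine[OF sm2, of 1 "-1"]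
        by (intro derivs_bounded_diff sm2) simp
      show "0 \<le> z" "z < W" if "\<sigma> z - \<sigma> (z - 1) \<noteq> 0" for z
        using that 0[of z] 0[of "z - 1"] 1[of z] 1[of "z - 1"] by (auto simp: W_def not_le) (smt (verit))+
      show "\<phi> 0 = (\<lambda>y. \<sigma> ((y - u) / b) - \<sigma> ((y - u) / b - 1))"
        using b by (simp add: \<phi>_def fun_eq_iff diff_divide_distrib add_divide_distrib algebra_simps)
    qed
    \<comment> \<open>Halving the scale at one endpoint replaces \<open>\<sigma> z\<close> by
      \<open>\<sigma> (2 * z)\<close>; both agree outside a bounded interval.\<close>
    have g1: "bump p K W h (\<lambda>y. \<sigma> (2 * ((y - v) / h)) - \<sigma> ((y - v) / h))" for h v
      unfolding bump_def
    proof (intro exI[of _ "\<lambda>z. \<sigma> (2 * z) - \<sigma> z"] exI[of _ v] conjI allI impI)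
      show "derivs_bounded p K 2 (\<lambda>z. \<sigma> (2 * z) - \<sigma> z)"
        unfolding K_def using derivs_bounded_affine[OF sm, of 2 0]
        by (intro derivs_bounded_diff sm2) (simp add: mult.commute)
      show "0 \<le> z" "z < W" if "\<sigma> (2 * z) - \<sigma> z \<noteq> 0" for z
        using that 0[of z] 0[of "2 * z"] 1[of z] 1[of "2 * z"] by (auto simp: W_def not_le) (smt (verit))+
    qed simp
    have rem: "interval_supported (W * h) (\<lambda>y. (if v \<le> y then 1 else 0) - \<sigma> ((y - v) / h))" if "0 < h" for v h
      unfolding interval_supported_def
    proof (intro exI[of _ v] allI impI)
      fix y assume nz: "(if v \<le> y then 1 else 0) - \<sigma> ((y - v) / h) \<noteq> 0"
      have "v \<le> y" using nz 0[of "(y - v) / h"] that by (auto simp: divide_le_0_iff split: if_splits)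
      moreover from this have "\<not> (y - v) / h \<ge> real p + 1" using nz 1[of "(y - v) / h"] by auto
      hence "(y - v) / h < W" by (simp add: W_def)
      hence "y < v + W * h" using that by (simp add: field_simps)
      ultimately show "v \<le> y \<and> y < v + W * h" by simp
    qed
    show "\<exists>\<phi>. bump p K W b (\<phi> 0) \<and>
        (\<forall>l. \<exists>f g. bump p K W (b / 2 ^ l) f \<and> bump p K W (b / 2 ^ l) g \<and>
        \<phi> (Suc l) = (\<lambda>y. (\<phi> l y + 1 * f y) + (- 1) * g y)) \<and>
      (\<forall>l. \<exists>f g. (\<forall>y. \<bar>f y\<bar> \<le> 1) \<and> interval_supported (W * (b / 2 ^ l)) f \<and>
        (\<forall>y. \<bar>g y\<bar> \<le> 1) \<and> interval_supported (W * (b / 2 ^ l)) g \<and>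
        indicat_real {u..<u + b} = (\<lambda>y. (\<phi> l y + 1 * f y) + (- 1) * g y))"
    proof (rule exI[of _ \<phi>], intro conjI allI)
      show "bump p K W b (\<phi> 0)" by (rule g0)
      fix l :: nat
      have "\<phi> (Suc l) = (\<lambda>y. (\<phi> l y + 1 * (\<sigma> (2 * ((y - u) / (b / 2 ^ l))) - \<sigma> ((y - u) / (b / 2 ^ l)))) +
          (- 1) * (\<sigma> (2 * ((y - (u + b)) / (b / 2 ^ l))) - \<sigma> ((y - (u + b)) / (b / 2 ^ l))))"
        by (simp add: \<phi>_def fun_eq_iff mult_ac)
      thus "\<exists>f g. bump p K W (b / 2 ^ l) f \<and> bump p K W (b / 2 ^ l) g \<and>
          \<phi> (Suc l) = (\<lambda>y. (\<phi> l y + 1 * f y) + (- 1) * g y)"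
        using g1 by blast
      define R where "R = (\<lambda>v y. (if v \<le> y then 1 else 0) - \<sigma> ((y - v) / (b / 2 ^ l)))"
      have "indicat_real {u..<u + b} = (\<lambda>y. (\<phi> l y + 1 * R u y) + (- 1) * R (u + b) y)"
        using b by (auto simp: fun_eq_iff \<phi>_def R_def indicator_def)
      moreover have "\<bar>R v y\<bar> \<le> 1" for v y using r[of "(y - v) / (b / 2 ^ l)"] by (simp add: R_def)
      moreover have "interval_supported (W * (b / 2 ^ l)) (R v)" for v
        unfolding R_def by (rule rem) (use b in simp)
      ultimately show "\<exists>f g. (\<forall>y. \<bar>f y\<bar> \<le> 1) \<and> interval_supported (W * (b / 2 ^ l)) f \<and>
          (\<forall>y. \<bar>g y\<bar> \<le> 1) \<and> interval_supported (W * (b / 2 ^ l)) g \<and>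
          indicat_real {u..<u + b} = (\<lambda>y. (\<phi> l y + 1 * f y) + (- 1) * g y)"
        by blast
    qed
  qed
qed

context admissible_lattice
begin

text \<open>The sum is periodic along the short lattice vectors, relative to which the bumps are flat:
  CARD('d) + 1 derivatives outweigh the number of lattice points in the support.\<close>

lemma bump_product_osc:
  assumes K: "0 \<le> K" and W: "0 < W"
  shows "\<exists>C\<ge>0. \<forall>q h. (\<forall>j. 0 < h j) \<longrightarrow> 1 \<le> (\<Prod>j\<in>UNIV. h j) \<longrightarrow>
    (\<forall>j. bump (CARD('d) + 1) K W (h j) (q j)) \<longrightarrow>
    osc_le (\<lambda>x. \<Prod>j\<in>UNIV. q j (x $ j)) (C / root CARD('d) (\<Prod>j\<in>UNIV. h j))"
proof -
  let ?d = "CARD('d)"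
  obtain H where H: "0 < H" and basis: "\<And>s :: 'd \<Rightarrow> real. (\<And>j. 0 < s j) \<Longrightarrow> (\<Prod>j\<in>UNIV. s j) = 1 \<Longrightarrow>
    \<exists>w :: 'd \<Rightarrow> real ^ 'd. (\<forall>i. w i \<in> X) \<and> (\<forall>i j. \<bar>w i $ j\<bar> \<le> H * s j) \<and>
      (\<forall>z. \<exists>t. z = (\<Sum>i\<in>UNIV. t i *\<^sub>R w i))"
    using short_vectors by blast
  define K' where "K' = (2 ^ (?d + 1) * K) ^ ?d"
  \<comment> \<open>Counts points met while the shift moves by less than one period either way,
    which widens the box by \<open>H * h j\<close> on each side. The summand 1 is absorbed using
    volume at least 1.\<close>
  define C1 where "C1 = (W + 2 * H) ^ ?d / nm + 1"
  define C where "C = ?d * (C1 * K' * (2 * H) ^ (?d + 1))"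
  have K': "0 \<le> K'" using K by (simp add: K'_def)
  have C1: "0 \<le> C1" using H W nm_pos by (simp add: C1_def)
  show ?thesis
  proof (intro exI[of _ C] conjI allI impI)
    show "0 \<le> C" using H K' C1 by (simp add: C_def)
    fix q :: "'d \<Rightarrow> real \<Rightarrow> real" and h :: "'d \<Rightarrow> real"
    assume h': "\<forall>j. 0 < h j" and v1: "1 \<le> (\<Prod>j\<in>UNIV. h j)"
      and q: "\<forall>j. bump (?d + 1) K W (h j) (q j)"
    have h: "0 < h j" for j using h' by blast
    have "\<forall>j. \<exists>gu. derivs_bounded (?d + 1) K 2 (fst gu) \<and> (\<forall>y. fst gu y \<noteq> 0 \<longrightarrow> 0 \<le> y \<and> y < W) \<and>
        q j = (\<lambda>y. fst gu ((y - snd gu) / h j))"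
      using q unfolding bump_def by simp
    from choice[OF this] obtain gu where gu: "\<And>j. derivs_bounded (?d + 1) K 2 (fst (gu j))"
      "\<And>j y. fst (gu j) y \<noteq> 0 \<Longrightarrow> 0 \<le> y \<and> y < W" "\<And>j. q j = (\<lambda>y. fst (gu j) ((y - snd (gu j)) / h j))"
      by blast
    define g where "g j = fst (gu j)" for j
    define u where "u j = snd (gu j)" for j
    have g: "derivs_bounded (?d + 1) K 2 (g j)" "g j y \<noteq> 0 \<Longrightarrow> 0 \<le> y \<and> y < W"
      "q j = (\<lambda>y. g j ((y - u j) / h j))" for j y
      using gu by (simp_all add: g_def u_def)
    define v where "v = (\<Prod>j\<in>UNIV. h j)"
    have v0: "v > 0" using v1 unfolding v_def by linarith
    \<comment> \<open>The geometric mean of the sides. Dividing the sides by it normalises their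
      product to 1, and the short vectors then have relative size at most
      \<open>H / \<theta>\<close>.\<close>
    define \<theta> where "\<theta> = root ?d v"
    have lam: "1 \<le> \<theta>" "\<theta> ^ ?d = v"
      using v1 real_root_ge_1_iff[of ?d v] real_root_pow_pos2[of ?d v] by (simp_all add: \<theta>_def v_def)
    define s where "s j = h j / \<theta>" for j
    have s: "0 < s j" for j using h lam by (simp add: s_def)
    have sh: "s j \<le> h j" for j using lam h[of j] by (simp add: s_def field_simps)
    have "(\<Prod>j\<in>UNIV. s j) = v / \<theta> ^ ?d" by (simp add: s_def v_def prod_dividef)
    also have "\<dots> = 1" unfolding lam(2) using v1 unfolding v_def by (intro divide_self) linarith
    finally obtain w :: "'d \<Rightarrow> real ^ 'd" where w: "\<And>i. w i \<in> X" "\<And>i j. \<bar>w i $ j\<bar> \<le> H * s j"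
      "\<And>z. \<exists>t. z = (\<Sum>i\<in>UNIV. t i *\<^sub>R w i)"
      using basis[of s, OF s] by blast
    \<comment> \<open>The factor 2 is the frequency of the bump profiles.\<close>
    define \<eta> where "\<eta> = 2 * H / \<theta>"
    have \<eta>: "0 \<le> \<eta>" using H lam by (simp add: \<eta>_def)
    define G where "G = (\<lambda>x :: real ^ 'd. \<Prod>j\<in>UNIV. q j (x $ j))"
    \<comment> \<open>Oscillation along one vector. The number of terms is
      O(\<open>\<theta> ^ ?d\<close>) and the derivatives give \<open>\<theta> ^ (?d + 1)\<close> in
      the denominator, leaving one factor \<open>1 / \<theta>\<close>.\<close>
    define E where "E = C1 * v * K' * \<eta> ^ (?d + 1)"
    have E: "?d * E = C / \<theta>"
      using lam v0 by (simp add: E_def C_def \<eta>_def power_divide field_simps)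
    have step: "\<bar>lsum G (\<delta> + t *\<^sub>R w i) - lsum G \<delta>\<bar> \<le> E" for \<delta> t i
    proof -
      define f where "f x s = (if x \<in> X then G (x + (\<delta> + s *\<^sub>R w i)) else 0)" for x s
      have "derivs_bounded (?d + 1) K' \<eta> (f x)" for x
      proof (cases "x \<in> X")
        case True
        have "derivs_bounded (?d + 1) K' \<eta>
          (\<lambda>s. \<Prod>j\<in>UNIV. g j (((x + \<delta>) $ j - u j) / h j + s * (w i $ j / h j)))"
          unfolding K'_def
        proof (rule derivs_bounded_prod)
          fix j
          have "\<bar>w i $ j / h j\<bar> \<le> H / \<theta>"
            using w(2)[of i j] h[of j] lam by (simp add: s_def field_simps)
          thus "derivs_bounded (?d + 1) K \<eta> (\<lambda>s. g j (((x + \<delta>) $ j - u j) / h j + s * (w i $ j / h j)))"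
            by (intro derivs_bounded_mono[OF derivs_bounded_affine[OF g(1)]]) (auto simp: \<eta>_def)
        qed (use \<eta> in auto)
        moreover have "f x = (\<lambda>s. \<Prod>j\<in>UNIV. g j (((x + \<delta>) $ j - u j) / h j + s * (w i $ j / h j)))"
          using True by (simp add: f_def G_def g(3) fun_eq_iff flip: add_divide_distrib) (simp add: algebra_simps)
        ultimately show ?thesis by simp
      next
        case False
        have "derivs_bounded (?d + 1) K' \<eta> (\<lambda>_. 0)"
          by (rule derivs_bounded_mono[OF derivs_bounded_zero K' \<eta>]) simp
        moreover have "f x = (\<lambda>_. 0)" using False by (simp add: f_def fun_eq_iff)
        ultimately show ?thesis by simp
      qed
      moreover have count: "finite {x. \<exists>s. \<bar>s - t\<bar> < 1 \<and> f x s \<noteq> 0}"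
        "real (card {x. \<exists>s. \<bar>s - t\<bar> < 1 \<and> f x s \<noteq> 0}) \<le> C1 * v" for t
      proof -
        define Z where "Z = {x. \<exists>s. \<bar>s - t\<bar> < 1 \<and> f x s \<noteq> 0}"
        define c where "c j = u j - \<delta> $ j - t * w i $ j - H * h j" for j
        have Z: "c j \<le> x $ j \<and> x $ j < c j + (W + 2 * H) * h j" if "x \<in> Z" for x j
        proof -
          from that obtain s' where s': "\<bar>s' - t\<bar> < 1" "f x s' \<noteq> 0" by (auto simp: Z_def)
          hence "q j ((x + (\<delta> + s' *\<^sub>R w i)) $ j) \<noteq> 0" by (auto simp: f_def G_def split: if_splits)
          hence "0 \<le> ((x + (\<delta> + s' *\<^sub>R w i)) $ j - u j) / h j \<and> ((x + (\<delta> + s' *\<^sub>R w i)) $ j - u j) / h j < W"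
            unfolding g(3) by (rule g(2))
          hence 1: "u j \<le> x $ j + \<delta> $ j + s' * w i $ j" "x $ j + \<delta> $ j + s' * w i $ j < u j + W * h j"
            using h[of j] by (auto simp: field_simps zero_le_divide_iff)
          have "\<bar>s' * w i $ j - t * w i $ j\<bar> = \<bar>s' - t\<bar> * \<bar>w i $ j\<bar>" by (simp add: left_diff_distrib flip: abs_mult)
          also have "\<dots> \<le> 1 * (H * s j)" using s' w(2) by (intro mult_mono) auto
          also have "\<dots> \<le> H * h j" using sh H by simp
          finally have "\<bar>s' * w i $ j - t * w i $ j\<bar> \<le> H * h j" .
          thus ?thesis using 1 by (simp add: c_def distrib_right) linarith
        qed
        have ZX: "Z \<subseteq> X" by (auto simp: Z_def f_def split: if_splits)
        have pos: "0 < (W + 2 * H) * h j" for j using W H h by simp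
        note lc = lattice_box_count[of Z c "\<lambda>j. (W + 2 * H) * h j", OF ZX Z pos]
        show "finite {x. \<exists>s. \<bar>s - t\<bar> < 1 \<and> f x s \<noteq> 0}" using lc(1) by (simp add: Z_def)
        have "real (card Z) \<le> (W + 2 * H) ^ ?d * v / nm + 1"
          using lc(2) by (simp add: prod.distrib v_def)
        also have "\<dots> \<le> (W + 2 * H) ^ ?d * v / nm + v" using v1 by (simp add: v_def)
        also have "\<dots> = C1 * v" by (simp add: C1_def field_simps)
        finally show "real (card {x. \<exists>s. \<bar>s - t\<bar> < 1 \<and> f x s \<noteq> 0}) \<le> C1 * v" by (simp add: Z_def)
      qed
      ultimately have "derivs_bounded (?d + 1) (C1 * v * K') \<eta> (\<lambda>t. fsum (\<lambda>x. f x t))"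
        by (intro derivs_bounded_fsum)
      hence sm: "derivs_bounded (Suc ?d) (C1 * v * K') \<eta> (\<lambda>t. lsum G (\<delta> + t *\<^sub>R w i))"
        by (simp add: f_def lsum_def add.assoc del: derivs_bounded.simps)
      have "lsum G (\<delta> + (t + 1) *\<^sub>R w i) = lsum G (\<delta> + t *\<^sub>R w i)" for t
        using lsum_shift[OF w(1), of G "\<delta> + t *\<^sub>R w i" i] by (simp add: scaleR_add_left add.assoc)
      from periodic_oscillation_le[OF sm this, of t 0] show ?thesis by (simp add: E_def)
    qed
    \<comment> \<open>An arbitrary displacement is travelled along one short vector after another,
      each leg costing \<open>E\<close>.\<close>
    have "\<bar>lsum G (\<delta> + (\<Sum>i\<in>I. t i *\<^sub>R w i)) - lsum G \<delta>\<bar> \<le> card I * E" if "finite I" for \<delta> t I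
      using that
    proof (induction I rule: finite_induct)
      case (insert i I)
      define z where "z = \<delta> + (\<Sum>i\<in>I. t i *\<^sub>R w i)"
      have z: "\<delta> + (\<Sum>i\<in>insert i I. t i *\<^sub>R w i) = z + t i *\<^sub>R w i"
        using insert by (simp add: z_def add_ac)
      have "\<bar>lsum G (z + t i *\<^sub>R w i) - lsum G z\<bar> \<le> E" by (rule step)
      moreover have "\<bar>lsum G z - lsum G \<delta>\<bar> \<le> card I * E" unfolding z_def by (rule insert.IH)
      ultimately have "\<bar>lsum G (z + t i *\<^sub>R w i) - lsum G \<delta>\<bar> \<le> E + card I * E" by linarith
      thus ?case unfolding z using insert by (simp add: distrib_right)
    qed simp
    note total = this[OF finite_class.finite_UNIV]
    have "\<bar>lsum G \<delta> - lsum G \<delta>'\<bar> \<le> ?d * E" for \<delta> \<delta>'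
    proof -
      obtain t where "\<delta> - \<delta>' = (\<Sum>i\<in>UNIV. t i *\<^sub>R w i)" using w(3) by blast
      thus ?thesis using total[of \<delta>' t] by (simp add: algebra_simps)
    qed
    moreover obtain c where "box_supported G c (\<lambda>j. W * h j)"
      unfolding G_def using box_supported_prod[of "\<lambda>j. W * h j" q] bump_interval_supported q h by blast
    hence "finite {x \<in> X. G (x + \<delta>) \<noteq> 0}" for \<delta>
      by (rule box_supported_count) (use W h in simp)
    ultimately show "osc_le (\<lambda>x. \<Prod>j\<in>UNIV. q j (x $ j)) (C / root ?d (\<Prod>j\<in>UNIV. h j))"
      unfolding osc_le_def E by (simp add: G_def \<theta>_def v_def)
  qed
qed

text \<open>The oscillation, up to a constant, of a product of \<open>r\<close> indicators and \<open>CARD('d) - r\<close> bumps on a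
  box of volume about \<open>2 ^ n\<close>.\<close>

definition osc_bound :: "nat \<Rightarrow> nat \<Rightarrow> real" where
  "osc_bound r n = (if r = 0 then (1 / root CARD('d) 2) ^ n else (real n + 1) ^ (r - 1))"

text \<open>The origin of the exponent \<open>CARD('d) - 1\<close>: the first summation over scales
  is geometric and costs nothing, and each later one costs a factor \<open>n + 1\<close>.\<close>

lemma sum_osc_bound:
  "\<exists>B\<ge>0. \<forall>n. (\<Sum>k\<le>n. osc_bound r k) \<le> B * osc_bound (Suc r) n"
proof (cases r)
  case 0
  define \<rho> where "\<rho> = 1 / root CARD('d) 2"
  have \<rho>: "0 < \<rho>" "\<rho> < 1" using real_root_gt_1_iff[of "CARD('d)" 2] by (auto simp: \<rho>_def)
  have "(\<Sum>k\<le>n. \<rho> ^ k) \<le> 1 / (1 - \<rho>)" for n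
    using \<rho> by (subst sum_gp0) (auto intro!: divide_right_mono)
  thus ?thesis using 0 \<rho> by (intro exI[of _ "1 / (1 - \<rho>)"]) (simp add: osc_bound_def flip: \<rho>_def)
next
  case (Suc m)
  have "(\<Sum>k\<le>n. (real k + 1) ^ m) \<le> (\<Sum>k\<le>n. (real n + 1) ^ m)" for n
    by (intro sum_mono power_mono) auto
  thus ?thesis using Suc by (intro exI[of _ 1]) (simp add: osc_bound_def add.commute)
qed

text \<open>Split one indicator at scales from its full length down to relative size \<open>2 ^ - n\<close>. At scale
  \<open>2 ^ - l\<close> the remaining product lives on volume \<open>2 ^ (n - l)\<close> with one indicator fewer, and the
  final remainder lives on bounded volume, hence contributes boundedly many points.\<close>

lemma mixed_product_osc:
  fixes K W :: real
  assumes K: "1 \<le> K" and W: "1 \<le> W"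
    and dec: "dyadic_splitting (CARD('d) + 1) K W"
  shows "\<exists>C\<ge>0. \<forall>A q h n. card (- A) = r \<longrightarrow> (\<forall>j. 0 < h j) \<longrightarrow>
    (\<forall>j\<in>A. bump (CARD('d) + 1) K W (h j) (q j)) \<longrightarrow>
    (\<forall>j\<in>-A. \<exists>u. q j = indicat_real {u..<u + h j}) \<longrightarrow>
    2 ^ n \<le> (\<Prod>j\<in>UNIV. h j) \<longrightarrow> (\<Prod>j\<in>UNIV. h j) \<le> 2 ^ Suc n \<longrightarrow>
    osc_le (\<lambda>x. \<Prod>j\<in>UNIV. q j (x $ j)) (C * osc_bound r n)"
proof (induction r)
  case 0
  obtain C where C: "0 \<le> C" and b: "\<forall>q h. (\<forall>j. 0 < h j) \<longrightarrow> 1 \<le> (\<Prod>j\<in>UNIV. h j) \<longrightarrow>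
    (\<forall>j. bump (CARD('d) + 1) K W (h j) (q j)) \<longrightarrow>
    osc_le (\<lambda>x. \<Prod>j\<in>UNIV. q j (x $ j)) (C / root CARD('d) (\<Prod>j\<in>UNIV. h j))"
  proof -
    have "0 \<le> K" "0 < W" using K W by simp_all
    from bump_product_osc[OF this] show ?thesis using that by (elim exE conjE)
  qed
  show ?case
  proof (intro exI[of _ C] conjI allI impI C)
    fix A :: "'d set" and q :: "'d \<Rightarrow> real \<Rightarrow> real" and h :: "'d \<Rightarrow> real" and n
    assume A: "card (- A) = 0" and h: "\<forall>j. 0 < h j" and q: "\<forall>j\<in>A. bump (CARD('d) + 1) K W (h j) (q j)"
      and n: "2 ^ n \<le> (\<Prod>j\<in>UNIV. h j)"
    have "A = UNIV" using A by auto
    moreover have "(1 :: real) \<le> 2 ^ n" by (rule one_le_power) simp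
    hence "1 \<le> (\<Prod>j\<in>UNIV. h j)" using n by linarith
    ultimately have osc: "osc_le (\<lambda>x. \<Prod>j\<in>UNIV. q j (x $ j)) (C / root CARD('d) (\<Prod>j\<in>UNIV. h j))"
      using b[rule_format, of h q] h q by simp
    have "C / root CARD('d) (\<Prod>j\<in>UNIV. h j) \<le> C / root CARD('d) (2 ^ n)"
      using n C by (intro divide_left_mono mult_pos_pos) (auto intro: order_less_le_trans[of _ "2 ^ n"])
    also have "\<dots> = C * osc_bound 0 n"
      by (simp add: osc_bound_def real_root_power power_one_over divide_inverse power_inverse)
    finally show "osc_le (\<lambda>x. \<Prod>j\<in>UNIV. q j (x $ j)) (C * osc_bound 0 n)"
      using osc by (rule osc_le_mono[rotated])
  qed
next
  case (Suc r)
  from Suc.IH obtain C where C: "0 \<le> C" and IH: "\<forall>A q h n. card (- A) = r \<longrightarrow> (\<forall>j. 0 < h j) \<longrightarrow>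
    (\<forall>j\<in>A. bump (CARD('d) + 1) K W (h j) (q j)) \<longrightarrow>
    (\<forall>j\<in>-A. \<exists>u. q j = indicat_real {u..<u + h j}) \<longrightarrow>
    2 ^ n \<le> (\<Prod>j\<in>UNIV. h j) \<longrightarrow> (\<Prod>j\<in>UNIV. h j) \<le> 2 ^ Suc n \<longrightarrow>
    osc_le (\<lambda>x. \<Prod>j\<in>UNIV. q j (x $ j)) (C * osc_bound r n)"
    by (elim exE conjE)
  obtain B where B: "0 \<le> B" "\<And>n. (\<Sum>k\<le>n. osc_bound r k) \<le> B * osc_bound (Suc r) n"
    using sum_osc_bound by blast
  \<comment> \<open>At relative size \<open>2 ^ - n\<close> a box of volume at most
    \<open>2 ^ Suc n\<close> has volume at most 2. The widened supports contribute
    \<open>W ^ CARD('d)\<close>, the factors \<open>K ^ CARD('d)\<close>.\<close>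
  define R where "R = 2 * (K ^ CARD('d) * (W ^ CARD('d) * 2 / nm + 1))"
  have R: "0 \<le> R" using K W nm_pos by (simp add: R_def)
  show ?case
  \<comment> \<open>One initial bump and two bumps per scale, each sum of bounds costing a factor
    \<open>B\<close>; then one remainder at each endpoint.\<close>
  proof (intro exI[of _ "3 * C * B + 2 * R"] conjI allI impI)
    show "0 \<le> 3 * C * B + 2 * R" using C B R by simp
    fix A :: "'d set" and q :: "'d \<Rightarrow> real \<Rightarrow> real" and h :: "'d \<Rightarrow> real" and n
    assume A: "card (- A) = Suc r" and h': "\<forall>j. 0 < h j"
      and q: "\<forall>j\<in>A. bump (CARD('d) + 1) K W (h j) (q j)"
      and ind: "\<forall>j\<in>-A. \<exists>u. q j = indicat_real {u..<u + h j}"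
      and n: "2 ^ n \<le> (\<Prod>j\<in>UNIV. h j)" "(\<Prod>j\<in>UNIV. h j) \<le> 2 ^ Suc n"
    have h: "0 < h j" for j using h' by blast
    obtain i where i: "i \<in> - A" using A by (cases "- A = {}") auto
    then obtain u where u: "q i = indicat_real {u..<u + h i}" using ind by blast
    define b where "b = h i"
    have b: "0 < b" using h by (simp add: b_def)
    obtain \<phi> where \<phi>0: "bump (CARD('d) + 1) K W b (\<phi> 0)"
      and \<phi>S: "\<And>l. \<exists>f g. bump (CARD('d) + 1) K W (b / 2 ^ l) f \<and> bump (CARD('d) + 1) K W (b / 2 ^ l) g \<and>
        \<phi> (Suc l) = (\<lambda>y. (\<phi> l y + 1 * f y) + (- 1) * g y)"
      and \<phi>r: "\<And>l. \<exists>f g. (\<forall>y. \<bar>f y\<bar> \<le> 1) \<and> interval_supported (W * (b / 2 ^ l)) f \<and>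
        (\<forall>y. \<bar>g y\<bar> \<le> 1) \<and> interval_supported (W * (b / 2 ^ l)) g \<and>
        indicat_real {u..<u + b} = (\<lambda>y. (\<phi> l y + 1 * f y) + (- 1) * g y)"
    proof -
      from dec[unfolded dyadic_splitting_def, rule_format, OF b, of u] show ?thesis using that by (elim exE conjE) blast
    qed
    define F where "F f = (\<lambda>x :: real ^ 'd. \<Prod>j\<in>UNIV. (q(i := f)) j (x $ j))" for f
    have vol: "(\<Prod>j\<in>UNIV. (h(i := c * b)) j) = c * (\<Prod>j\<in>UNIV. h j)" for c
    proof -
      have "(\<Prod>j\<in>UNIV. (h(i := c * b)) j) = c * b * (\<Prod>j\<in>UNIV - {i}. h j)"
        by (subst prod.remove[of _ i]) (auto intro: prod.cong)
      also have "\<dots> = c * (b * (\<Prod>j\<in>UNIV - {i}. h j))" by simp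
      also have "b * (\<Prod>j\<in>UNIV - {i}. h j) = (\<Prod>j\<in>UNIV. h j)"
        unfolding b_def by (subst (2) prod.remove[of _ i]) auto
      finally show ?thesis .
    qed
    have F_eq: "F f x = f (x $ i) * (\<Prod>j\<in>UNIV - {i}. q j (x $ j))" for f x
      unfolding F_def by (subst prod.remove[of _ i]) (auto intro: prod.cong)
    have F_add: "F (\<lambda>y. f y + c * g y) = (\<lambda>x. F f x + c * F g x)" for f g c
      by (simp add: F_eq fun_eq_iff algebra_simps)
    have qsupp: "interval_supported (W * h j) (q j)" for j
    proof (cases "j \<in> A")
      case True
      thus ?thesis using q h by (intro bump_interval_supported) auto
    next
      case False
      then obtain v where v: "q j = indicat_real {v..<v + h j}" using ind by blast
      have "interval_supported (h j) (q j)" unfolding interval_supported_def v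
        by (rule exI[of _ v]) (auto simp: indicator_def)
      thus ?thesis by (rule interval_supported_mono) (use W h[of j] in simp)
    qed
    have qK: "\<bar>q j y\<bar> \<le> K" for j y
    proof (cases "j \<in> A")
      case True
      thus ?thesis using q bump_abs_le by blast
    next
      case False
      then obtain v where v: "q j = indicat_real {v..<v + h j}" using ind by blast
      thus ?thesis using K by (auto simp: indicator_def)
    qed
    have osc_diff: "osc_le (F (\<lambda>y. (f0 y + 1 * f y) + (- 1) * g y)) (e0 + e + e)"
      if "osc_le (F f0) e0" "osc_le (F f) e" "osc_le (F g) e" for f0 f g e0 e
      unfolding F_add using that by (intro osc_le_add_mult) auto
    \<comment> \<open>Coordinate \<open>i\<close> joins the bumps and its side shrinks by
      \<open>2 ^ l\<close>, which moves the volume to the dyadic class \<open>n - l\<close>.\<close>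
    have osc_bump: "osc_le (F f) (C * osc_bound r (n - l))"
      if f: "bump (CARD('d) + 1) K W (b / 2 ^ l) f" and l: "l \<le> n" for f l
      unfolding F_def
    proof (rule IH[rule_format, where A = "insert i A" and h = "h(i := 1 / 2 ^ l * b)"])
      have "- insert i A = - A - {i}" by auto
      thus "card (- insert i A) = r" using A i by (simp add: card_Diff_singleton)
      show "0 < (h(i := 1 / 2 ^ l * b)) j" for j using h[of j] b by simp
      show "bump (CARD('d) + 1) K W ((h(i := 1 / 2 ^ l * b)) j) ((q(i := f)) j)" if "j \<in> insert i A" for j
        using that q f by auto
      show "\<exists>u. (q(i := f)) j = indicat_real {u..<u + (h(i := 1 / 2 ^ l * b)) j}" if "j \<in> - insert i A" for j
        using that ind by auto
      have "(2 :: real) ^ n = 2 ^ (n - l) * 2 ^ l" "(2 :: real) ^ Suc n = 2 ^ Suc (n - l) * 2 ^ l"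
        using l by (simp_all flip: power_add)
      thus "2 ^ (n - l) \<le> (\<Prod>j\<in>UNIV. (h(i := 1 / 2 ^ l * b)) j)"
        "(\<Prod>j\<in>UNIV. (h(i := 1 / 2 ^ l * b)) j) \<le> 2 ^ Suc (n - l)"
        unfolding vol using n by (simp_all add: pos_le_divide_eq pos_divide_le_eq)
    qed
    have osc_\<phi>: "osc_le (F (\<phi> l)) (C * osc_bound r n + 2 * C * (\<Sum>k<l. osc_bound r (n - k)))" if "l \<le> n" for l
      using that
    proof (induction l)
      case 0
      show ?case using osc_bump[of 0 "\<phi> 0"] \<phi>0 by simp
    next
      case (Suc l)
      obtain f g where fg: "bump (CARD('d) + 1) K W (b / 2 ^ l) f" "bump (CARD('d) + 1) K W (b / 2 ^ l) g"
        "\<phi> (Suc l) = (\<lambda>y. (\<phi> l y + 1 * f y) + (- 1) * g y)" using \<phi>S by blast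
      have "osc_le (F (\<phi> (Suc l))) (C * osc_bound r n + 2 * C * (\<Sum>k<l. osc_bound r (n - k)) +
          C * osc_bound r (n - l) + C * osc_bound r (n - l))"
        unfolding fg(3) using Suc fg by (intro osc_diff osc_bump) auto
      thus ?case by (rule osc_le_mono) (simp add: algebra_simps)
    qed
    have osc_rem: "osc_le (F f) R"
      if f: "\<And>y. \<bar>f y\<bar> \<le> 1" "interval_supported (W * (b / 2 ^ n)) f" for f
    proof -
      let ?h = "h(i := 1 / 2 ^ n * b)"
      have "\<exists>v. box_supported (F f) v (\<lambda>j. W * ?h j)"
        unfolding F_def using f(2) qsupp by (intro box_supported_prod) auto
      then obtain v where v: "box_supported (F f) v (\<lambda>j. W * ?h j)" by blast
      have "\<bar>F f x\<bar> \<le> (\<Prod>j\<in>(UNIV :: 'd set). K)" for x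
        unfolding F_def abs_prod using f(1) K qK by (intro prod_mono) (auto intro: order_trans)
      hence bd: "\<bar>F f x\<bar> \<le> K ^ CARD('d)" for x by simp
      have "osc_le (F f) (2 * (K ^ CARD('d) * ((\<Prod>j\<in>UNIV. W * ?h j) / nm + 1)))"
        by (rule osc_le_bounded[OF v _ bd]) (use W h b in auto)
      moreover have "(\<Prod>j\<in>UNIV. W * ?h j) \<le> W ^ CARD('d) * 2"
        unfolding prod.distrib vol using n W by (auto simp: field_simps intro!: mult_left_mono)
      ultimately show ?thesis
        unfolding R_def using K nm_pos
        by (elim osc_le_mono) (intro mult_left_mono add_right_mono divide_right_mono, auto)
    qed
    obtain f g where fg: "\<And>y. \<bar>f y\<bar> \<le> 1" "interval_supported (W * (b / 2 ^ n)) f"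
      "\<And>y. \<bar>g y\<bar> \<le> 1" "interval_supported (W * (b / 2 ^ n)) g"
      "indicat_real {u..<u + b} = (\<lambda>y. (\<phi> n y + 1 * f y) + (- 1) * g y)"
      using \<phi>r by blast
    have "osc_le (F (indicat_real {u..<u + b})) (C * osc_bound r n + 2 * C * (\<Sum>k<n. osc_bound r (n - k)) + R + R)"
      unfolding fg(5) using fg by (intro osc_diff osc_\<phi> osc_rem) auto
    moreover have "F (indicat_real {u..<u + b}) = (\<lambda>x. \<Prod>j\<in>UNIV. q j (x $ j))"
      using u by (simp add: F_def b_def fun_upd_idem)
    moreover have "C * osc_bound r n + 2 * C * (\<Sum>k<n. osc_bound r (n - k)) + R + R \<le>
        (3 * C * B + 2 * R) * osc_bound (Suc r) n"
    proof -
      have pos: "0 \<le> osc_bound r k" for k by (simp add: osc_bound_def)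
      have "(\<Sum>k\<le>n. osc_bound r k) = (\<Sum>k\<le>n. osc_bound r (n - k))"
        by (rule sum.nat_diff_reindex[symmetric, of _ "Suc n", simplified lessThan_Suc_atMost, simplified])
      also have "\<dots> = (\<Sum>k<n. osc_bound r (n - k)) + osc_bound r 0"
        by (simp flip: lessThan_Suc_atMost)
      finally have "(\<Sum>k<n. osc_bound r (n - k)) + osc_bound r 0 \<le> B * osc_bound (Suc r) n"
        using B(2)[of n] by simp
      hence *: "(\<Sum>k<n. osc_bound r (n - k)) \<le> B * osc_bound (Suc r) n" using pos[of 0] by linarith
      have "osc_bound r n \<le> (\<Sum>k\<le>n. osc_bound r k)" using pos by (intro member_le_sum) auto
      also have "\<dots> \<le> B * osc_bound (Suc r) n" by (rule B(2))
      finally have "C * osc_bound r n + 2 * C * (\<Sum>k<n. osc_bound r (n - k)) + R + R \<le>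
        C * (B * osc_bound (Suc r) n) + 2 * C * (B * osc_bound (Suc r) n) + R + R"
        using * C by (intro add_mono mult_left_mono) auto
      moreover have "1 \<le> osc_bound (Suc r) n" by (simp add: osc_bound_def)
      hence "R * 1 \<le> R * osc_bound (Suc r) n" using R by (rule mult_left_mono)
      ultimately show ?thesis by (simp add: algebra_simps)
    qed
    ultimately show "osc_le (\<lambda>x. \<Prod>j\<in>UNIV. q j (x $ j)) ((3 * C * B + 2 * R) * osc_bound (Suc r) n)"
      by (simp only: osc_le_mono)
  qed
qed

end

section \<open>Discrepancy and mesh ratio\<close>

text \<open>Main term minus error in the point count. An exponential lower bound turns a dyadic
  exponent into O(log N); the base \<open>sqrt 2\<close> works because \<open>2 ^ m\<close> splits
  into two equal factors, one of which absorbs the polynomial.\<close>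

lemma exp_minus_poly_growth:
  fixes V C :: real
  assumes "0 < V"
  shows "\<exists>M. \<forall>m\<ge>M. sqrt 2 ^ m \<le> 2 ^ m / V - C * (real m + 1) ^ k"
proof -
  have poly: "(\<lambda>m. (real m + 1) ^ k / sqrt 2 ^ m) \<longlonglongrightarrow> 0" for k by real_asymp
  have "(\<lambda>m. 1 / sqrt 2 ^ m + C * ((real m + 1) ^ k / sqrt 2 ^ m) * (1 / sqrt 2 ^ m)) \<longlonglongrightarrow> 0 + C * 0 * 0"
    using poly[of 0] poly[of k] by (intro tendsto_intros) simp_all
  hence "eventually (\<lambda>m. 1 / sqrt 2 ^ m + C * ((real m + 1) ^ k / sqrt 2 ^ m) * (1 / sqrt 2 ^ m) < 1 / V) sequentially"
    by (rule order_tendstoD) (use assms in simp)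
  hence "eventually (\<lambda>m. sqrt 2 ^ m \<le> 2 ^ m / V - C * (real m + 1) ^ k) sequentially"
  proof eventually_elim
    case (elim m)
    have sq: "sqrt 2 ^ m * sqrt 2 ^ m = (2 :: real) ^ m" by (simp flip: power_mult_distrib)
    have "(1 / sqrt 2 ^ m + C * ((real m + 1) ^ k / sqrt 2 ^ m) * (1 / sqrt 2 ^ m)) * (sqrt 2 ^ m * sqrt 2 ^ m)
        \<le> 1 / V * (sqrt 2 ^ m * sqrt 2 ^ m)"
      using elim by (intro mult_right_mono less_imp_le) auto
    moreover have "(1 / sqrt 2 ^ m + C * ((real m + 1) ^ k / sqrt 2 ^ m) * (1 / sqrt 2 ^ m)) * (sqrt 2 ^ m * sqrt 2 ^ m)
        = sqrt 2 ^ m + C * (real m + 1) ^ k" by (simp add: distrib_right)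
    ultimately show ?case unfolding sq by simp
  qed
  thus ?thesis by (simp add: eventually_sequentially)
qed

section \<open>Comparison with the maximum norm, uniformly in \<open>p\<close>\<close>

lemma abs_component_le_p_norm:
  assumes "1 \<le> p"
  shows "\<bar>x $ j\<bar> \<le> p_norm p (x :: real ^ 'd)"
proof (cases "p = \<infinity>")
  case True
  thus ?thesis by (simp add: p_norm_def component_le_infnorm_cart)
next
  case False
  define r where "r = real_of_ereal p"
  have r: "1 \<le> r" using assms False by (cases p) (auto simp: r_def)
  have "\<bar>x $ j\<bar> = (\<bar>x $ j\<bar> powr r) powr (1 / r)" using r by (simp add: powr_powr)
  also have "\<dots> \<le> (\<Sum>j\<in>UNIV. \<bar>x $ j\<bar> powr r) powr (1 / r)"
    using r by (intro powr_mono2 member_le_sum) auto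
  finally show ?thesis using False by (simp add: p_norm_def r_def)
qed

lemma p_norm_le:
  fixes x :: "real ^ 'd" and B :: real
  assumes "1 \<le> p" and x: "\<And>j. \<bar>x $ j\<bar> \<le> B"
  shows "p_norm p x \<le> CARD('d) * B"
proof (cases "p = \<infinity>")
  case True
  have B: "0 \<le> B" using x[of undefined] by linarith
  have "infnorm x \<le> B" unfolding infnorm_cart using x by (intro cSup_least) auto
  also have "\<dots> \<le> CARD('d) * B" using mult_right_mono[of 1 "real CARD('d)" B] B by simp
  finally show ?thesis using True by (simp add: p_norm_def)
next
  case False
  define r where "r = real_of_ereal p"
  have r: "1 \<le> r" using assms(1) False by (cases p) (auto simp: r_def)
  have B: "0 \<le> B" using x[of undefined] by linarith
  have "(\<Sum>j\<in>UNIV. \<bar>x $ j\<bar> powr r) \<le> (\<Sum>j\<in>(UNIV :: 'd set). B powr r)"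
    using r x by (intro sum_mono powr_mono2) auto
  hence "(\<Sum>j\<in>UNIV. \<bar>x $ j\<bar> powr r) powr (1 / r) \<le> (real CARD('d) * B powr r) powr (1 / r)"
    using r by (intro powr_mono2 sum_nonneg) auto
  also have "\<dots> = real CARD('d) powr (1 / r) * B"
    using r B by (simp add: powr_mult powr_powr)
  also have "\<dots> \<le> real CARD('d) powr 1 * B"
    using r B by (intro mult_right_mono powr_mono) auto
  finally show ?thesis using False by (simp add: p_norm_def r_def)
qed

context admissible_lattice
begin

text \<open>All coordinates now carry indicators. The lower bound on the volume is removed, as thin
  boxes occur in the star-discrepancy: below volume 1 the trivial bound suffices, otherwise the box
  is treated in its own dyadic class \<open>m \<le> n\<close>.\<close>

lemma box_osc:
  "\<exists>C\<ge>0. \<forall>q h n. (\<forall>j. 0 < h j) \<longrightarrow> (\<forall>j. \<exists>u. q j = indicat_real {u..<u + h j}) \<longrightarrow>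
    (\<Prod>j\<in>UNIV. h j) \<le> 2 ^ Suc n \<longrightarrow>
    osc_le (\<lambda>x. \<Prod>j\<in>UNIV. q j (x $ j)) (C * (real n + 1) ^ (CARD('d) - 1))"
proof -
  obtain K W :: real where KW: "1 \<le> K" "1 \<le> W" "dyadic_splitting (CARD('d) + 1) K W"
    using interval_decomposition by blast
  from mixed_product_osc[OF KW, of "CARD('d)"]
  obtain C where C: "0 \<le> C" and osc: "\<forall>A q h n. card (- A) = CARD('d) \<longrightarrow> (\<forall>j. 0 < h j) \<longrightarrow>
    (\<forall>j\<in>A. bump (CARD('d) + 1) K W (h j) (q j)) \<longrightarrow>
    (\<forall>j\<in>-A. \<exists>u. q j = indicat_real {u..<u + h j}) \<longrightarrow>
    2 ^ n \<le> (\<Prod>j\<in>UNIV. h j) \<longrightarrow> (\<Prod>j\<in>UNIV. h j) \<le> 2 ^ Suc n \<longrightarrow>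
    osc_le (\<lambda>x. \<Prod>j\<in>UNIV. q j (x $ j)) (C * osc_bound CARD('d) n)"
    by (elim exE conjE)
  define C' where "C' = max C (2 * (1 / nm + 1))"
  show ?thesis
  proof (intro exI[of _ C'] conjI allI impI)
    show "0 \<le> C'" using C by (simp add: C'_def)
    fix q :: "'d \<Rightarrow> real \<Rightarrow> real" and h :: "'d \<Rightarrow> real" and n
    assume h: "\<forall>j. 0 < h j" and q: "\<forall>j. \<exists>u. q j = indicat_real {u..<u + h j}"
      and n: "(\<Prod>j\<in>UNIV. h j) \<le> 2 ^ Suc n"
    have ge1: "1 \<le> (real n + 1) ^ (CARD('d) - 1)" by (intro one_le_power) simp
    show "osc_le (\<lambda>x. \<Prod>j\<in>UNIV. q j (x $ j)) (C' * (real n + 1) ^ (CARD('d) - 1))"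
    proof (cases "(\<Prod>j\<in>UNIV. h j) < 1")
      case True
      have "interval_supported (h j) (q j)" for j
      proof -
        obtain u where "q j = indicat_real {u..<u + h j}" using q by blast
        thus ?thesis unfolding interval_supported_def by (intro exI[of _ u]) (auto simp: indicator_def)
      qed
      then obtain u where u: "box_supported (\<lambda>x. \<Prod>j\<in>UNIV. q j (x $ j)) u h"
        using box_supported_prod[of h q] by blast
      have q01: "0 \<le> q j y \<and> q j y \<le> 1" for j y
      proof -
        obtain u where "q j = indicat_real {u..<u + h j}" using q by blast
        thus ?thesis by simp
      qed
      have "\<bar>\<Prod>j\<in>UNIV. q j (x $ j)\<bar> \<le> 1" for x :: "real ^ 'd"
        unfolding abs_prod using q01 by (intro prod_le_1) auto
      from osc_le_bounded[OF u _ this] h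
      have "osc_le (\<lambda>x. \<Prod>j\<in>UNIV. q j (x $ j)) (2 * (1 * ((\<Prod>j\<in>UNIV. h j) / nm + 1)))" by simp
      moreover have "2 * (1 * ((\<Prod>j\<in>UNIV. h j) / nm + 1)) \<le> 2 * (1 / nm + 1)"
        using True nm_pos by (auto intro!: divide_right_mono)
      moreover have "\<dots> \<le> C'" by (simp add: C'_def)
      moreover have "\<dots> * 1 \<le> C' * (real n + 1) ^ (CARD('d) - 1)"
        using ge1 C by (intro mult_left_mono) (auto simp: C'_def)
      ultimately show ?thesis by (elim osc_le_mono) linarith
    next
      case False
      define m where "m = (LEAST m. (\<Prod>j\<in>UNIV. h j) \<le> 2 ^ Suc m)"
      have m: "(\<Prod>j\<in>UNIV. h j) \<le> 2 ^ Suc m" "m \<le> n"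
        unfolding m_def using n by (rule LeastI, rule Least_le)
      have "2 ^ m \<le> (\<Prod>j\<in>UNIV. h j)"
      proof (cases m)
        case (Suc k)
        hence "\<not> (\<Prod>j\<in>UNIV. h j) \<le> 2 ^ Suc k" unfolding m_def using not_less_Least by (metis lessI)
        thus ?thesis using Suc by simp
      qed (use False in simp)
      hence "osc_le (\<lambda>x. \<Prod>j\<in>UNIV. q j (x $ j)) (C * osc_bound CARD('d) m)"
        using osc[rule_format, of "{}" h q m] h q m by simp
      moreover have "C * osc_bound CARD('d) m \<le> C' * (real n + 1) ^ (CARD('d) - 1)"
        using m C by (auto simp: osc_bound_def C'_def intro!: mult_mono power_mono)
      ultimately show ?thesis by (rule osc_le_mono)
    qed
  qed
qed

text \<open>Any count differs from every other by at most the oscillation, hence also from their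
  average, which is volume over \<open>covol\<close>.\<close>

lemma box_count:
  "\<exists>C\<ge>0. \<forall>(u :: real ^ 'd) v \<delta> n. (\<forall>j. u $ j < v $ j) \<longrightarrow> (\<Prod>j\<in>UNIV. v $ j - u $ j) \<le> 2 ^ Suc n \<longrightarrow>
    \<bar>real (card {x \<in> X. x + \<delta> \<in> half_open_box u v}) - (\<Prod>j\<in>UNIV. v $ j - u $ j) / covol\<bar>
      \<le> C * (real n + 1) ^ (CARD('d) - 1)"
proof -
  obtain C where C: "0 \<le> C" and osc: "\<forall>q h n. (\<forall>j. 0 < h j) \<longrightarrow> (\<forall>j. \<exists>u. q j = indicat_real {u..<u + h j}) \<longrightarrow>
    (\<Prod>j\<in>UNIV. h j) \<le> 2 ^ Suc n \<longrightarrow>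
    osc_le (\<lambda>x. \<Prod>j\<in>UNIV. q j (x $ j)) (C * (real n + 1) ^ (CARD('d) - 1))"
    using box_osc by (elim exE conjE)
  show ?thesis
  proof (intro exI[of _ C] conjI allI impI C)
    fix u v \<delta> :: "real ^ 'd" and n
    assume uv: "\<forall>j. u $ j < v $ j" and n: "(\<Prod>j\<in>UNIV. v $ j - u $ j) \<le> 2 ^ Suc n"
    define B where "B = half_open_box u v"
    define q where "q j = indicat_real {u $ j..<u $ j + (v $ j - u $ j)}" for j
    define E where "E = C * (real n + 1) ^ (CARD('d) - 1)"
    define G where "G = (\<lambda>x :: real ^ 'd. \<Prod>j\<in>UNIV. q j (x $ j))"
    have osc: "osc_le G E"
      unfolding G_def E_def
    proof (rule osc[rule_format, of "\<lambda>j. v $ j - u $ j" q n])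
      show "\<exists>c. q j = indicat_real {c..<c + (v $ j - u $ j)}" for j unfolding q_def by blast
    qed (use uv n in auto)
    have G: "G x = indicator B x" for x
      by (auto simp: G_def q_def B_def half_open_box_def indicator_def)
    have lsum: "lsum G \<delta> = real (card {x \<in> X. x + \<delta> \<in> B})" for \<delta>
    proof -
      have "finite {x \<in> X. G (x + \<delta>) \<noteq> 0}" using osc by (simp add: osc_le_def)
      hence "finite {x \<in> X. x + \<delta> \<in> B}" by (simp add: G indicator_eq_0_iff)
      hence "lsum G \<delta> = (\<Sum>x\<in>{x \<in> X. x + \<delta> \<in> B}. G (x + \<delta>))"
        by (intro lsum_eq) (auto simp: G indicator_eq_0_iff)
      also have "\<dots> = (\<Sum>x\<in>{x \<in> X. x + \<delta> \<in> B}. 1)" by (intro sum.cong) (auto simp: G)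
      finally show ?thesis by simp
    qed
    have bounds: "lsum G \<delta> - E \<le> lsum G \<delta>'" "lsum G \<delta>' \<le> lsum G \<delta> + E" for \<delta>'
    proof -
      have "\<bar>lsum G \<delta> - lsum G \<delta>'\<bar> \<le> E" using osc unfolding osc_le_def by blast
      thus "lsum G \<delta> - E \<le> lsum G \<delta>'" "lsum G \<delta>' \<le> lsum G \<delta> + E" by linarith+
    qed
    have le: "u $ j \<le> v $ j" for j using uv less_imp_le by blast
    have B: "bounded B" "B \<in> sets lebesgue" "measure lebesgue B = (\<Prod>j\<in>UNIV. v $ j - u $ j)"
      unfolding B_def using bounded_half_open_box[of u v] measure_half_open_box[OF le] fmeasurableD by blast+
    have "(lsum G \<delta> - E) * covol \<le> measure lebesgue B"
      by (rule average_count(1)[OF B(1,2)]) (use bounds(1) lsum in simp)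
    moreover have "measure lebesgue B \<le> (lsum G \<delta> + E) * covol"
      by (rule average_count(2)[OF B(1,2)]) (use bounds(2) lsum in simp)
    ultimately have "lsum G \<delta> - E \<le> measure lebesgue B / covol" "measure lebesgue B / covol \<le> lsum G \<delta> + E"
      using covol_pos by (simp_all add: pos_le_divide_eq pos_divide_le_eq)
    thus "\<bar>real (card {x \<in> X. x + \<delta> \<in> half_open_box u v}) - (\<Prod>j\<in>UNIV. v $ j - u $ j) / covol\<bar>
      \<le> C * (real n + 1) ^ (CARD('d) - 1)"
      unfolding B(3) lsum by (simp add: B_def E_def abs_le_iff)
  qed
qed

section \<open>The scaled point sets and their discrepancy\<close>

lemma lattice_points_subbox_card:
  assumes a: "0 < a" and \<alpha>: "\<And>j. \<alpha> $ j \<le> 1"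
  shows "card (lattice_points T a \<delta> \<inter> half_open_box 0 \<alpha>) =
    card {x \<in> X. x + (- \<delta>) \<in> half_open_box 0 (a *\<^sub>R \<alpha>)}"
proof -
  let ?f = "\<lambda>x. inverse a *\<^sub>R (x - \<delta>)"
  have "?f x \<in> half_open_box 0 \<alpha> \<longleftrightarrow> x - \<delta> \<in> half_open_box 0 (a *\<^sub>R \<alpha>)" for x
    using a by (simp add: half_open_box_def field_simps zero_le_divide_iff)
  moreover have "half_open_box 0 \<alpha> \<subseteq> half_open_box 0 1"
    using \<alpha> by (auto simp: half_open_box_def intro: less_le_trans)
  ultimately have "lattice_points T a \<delta> \<inter> half_open_box 0 \<alpha> =
    ?f ` {x \<in> X. x + (- \<delta>) \<in> half_open_box 0 (a *\<^sub>R \<alpha>)}"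
    unfolding lattice_points_def by auto
  moreover have "inj_on ?f A" for A using a by (auto intro: inj_onI)
  ultimately show ?thesis by (simp add: card_image)
qed

lemma finite_lattice_points:
  assumes "0 < a"
  shows "finite (lattice_points T a \<delta>)"
proof -
  have "lattice_points T a \<delta> \<subseteq> (\<lambda>x. inverse a *\<^sub>R (x - \<delta>)) ` (X \<inter> (\<lambda>y. \<delta> + a *\<^sub>R y) ` half_open_box 0 1)"
    using assms by (force simp: lattice_points_def image_iff)
  moreover have "bounded ((\<lambda>y. \<delta> + a *\<^sub>R y) ` half_open_box 0 1)"
    using bounded_translation[OF bounded_scaling[OF bounded_half_open_box[of 0 "1 :: real ^ 'd"], of a], of \<delta>]
    by (simp add: image_image)
  ultimately show ?thesis using finite_lattice_bounded finite_subset by blast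
qed

lemma lattice_points_discrepancy_aux:
  "\<exists>C\<ge>0. \<forall>a \<delta> n. 0 < a \<longrightarrow> a ^ CARD('d) \<le> 2 ^ Suc n \<longrightarrow>
    \<bar>real (card (lattice_points T a \<delta>)) - a ^ CARD('d) / covol\<bar> \<le> C * (real n + 1) ^ (CARD('d) - 1) \<and>
    (lattice_points T a \<delta> \<noteq> {} \<longrightarrow> star_discrepancy (lattice_points T a \<delta>) \<le>
      2 * C * (real n + 1) ^ (CARD('d) - 1) / real (card (lattice_points T a \<delta>)))"
proof -
  obtain C where C: "0 \<le> C" and count: "\<forall>(u :: real ^ 'd) v \<delta> n. (\<forall>j. u $ j < v $ j) \<longrightarrow>
    (\<Prod>j\<in>UNIV. v $ j - u $ j) \<le> 2 ^ Suc n \<longrightarrow>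
    \<bar>real (card {x \<in> X. x + \<delta> \<in> half_open_box u v}) - (\<Prod>j\<in>UNIV. v $ j - u $ j) / covol\<bar>
      \<le> C * (real n + 1) ^ (CARD('d) - 1)"
    using box_count by (elim exE conjE)
  show ?thesis
  proof (rule exI[of _ C], intro conjI allI impI)
    show "0 \<le> C" by (rule C)
    fix a :: real and \<delta> :: "real ^ 'd" and n
    assume a: "0 < a" and n: "a ^ CARD('d) \<le> 2 ^ Suc n"
    define P where "P = lattice_points T a \<delta>"
    define E where "E = C * (real n + 1) ^ (CARD('d) - 1)"
    have E: "0 \<le> E" using C by (simp add: E_def)
    have sub: "\<bar>real (card (P \<inter> half_open_box 0 \<alpha>)) - a ^ CARD('d) * (\<Prod>j\<in>UNIV. \<alpha> $ j) / covol\<bar> \<le> E"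
      if \<alpha>: "\<And>j. 0 \<le> \<alpha> $ j" "\<And>j. \<alpha> $ j \<le> 1" for \<alpha> :: "real ^ 'd"
    \<comment> \<open>A side of length 0 makes the box empty; \<open>box_count\<close> assumes
      positive sides.\<close>
    proof (cases "\<exists>j. \<alpha> $ j = 0")
      case True
      then obtain j where j: "\<alpha> $ j = 0" by blast
      hence vol0: "(\<Prod>j\<in>UNIV. \<alpha> $ j) = 0" by auto
      have "half_open_box 0 \<alpha> = {}"
        using j by (auto simp: half_open_box_def not_less intro!: exI[of _ j])
      thus ?thesis unfolding vol0 using E by simp
    next
      case False
      hence pos: "0 < \<alpha> $ j" for j using \<alpha>(1)[of j] by (metis less_eq_real_def)
      have vol: "(\<Prod>j\<in>UNIV. (a *\<^sub>R \<alpha>) $ j - 0 $ j) = a ^ CARD('d) * (\<Prod>j\<in>UNIV. \<alpha> $ j)"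
        by (simp add: prod.distrib)
      have "(\<Prod>j\<in>UNIV. \<alpha> $ j) \<le> 1" using \<alpha> by (intro prod_le_1) auto
      hence "a ^ CARD('d) * (\<Prod>j\<in>UNIV. \<alpha> $ j) \<le> a ^ CARD('d)" using a by (intro mult_left_le) auto
      hence "(\<Prod>j\<in>UNIV. (a *\<^sub>R \<alpha>) $ j - 0 $ j) \<le> 2 ^ Suc n" unfolding vol using n by linarith
      from count[rule_format, OF _ this, of "- \<delta>"] show ?thesis
        unfolding vol P_def lattice_points_subbox_card[OF a \<alpha>(2)] E_def using a pos by simp
    qed
    have "P \<inter> half_open_box 0 1 = P" by (auto simp: P_def lattice_points_def)
    with sub[of 1] have N: "\<bar>real (card P) - a ^ CARD('d) / covol\<bar> \<le> E" by simp
    thus "\<bar>real (card (lattice_points T a \<delta>)) - a ^ CARD('d) / covol\<bar> \<le> C * (real n + 1) ^ (CARD('d) - 1)"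
      by (simp add: P_def E_def)
    assume "lattice_points T a \<delta> \<noteq> {}"
    hence card: "0 < card P" using finite_lattice_points[OF a] by (simp add: P_def card_gt_0_iff)
    have "star_discrepancy P \<le> 2 * E / card P"
      unfolding star_discrepancy_def
    proof (rule cSUP_least)
      show "cbox 0 (1 :: real ^ 'd) \<noteq> {}" by (auto simp: mem_box_cart intro!: exI[of _ 0] simp flip: ex_in_conv)
      fix \<alpha> :: "real ^ 'd" assume "\<alpha> \<in> cbox 0 1"
      hence \<alpha>: "0 \<le> \<alpha> $ j" "\<alpha> $ j \<le> 1" for j by (auto simp: mem_box_cart)
      define p where "p = (\<Prod>j\<in>UNIV. \<alpha> $ j)"
      define M where "M = real (card (P \<inter> half_open_box 0 \<alpha>))"
      have p: "0 \<le> p" "p \<le> 1" unfolding p_def using \<alpha> by (auto intro: prod_nonneg prod_le_1)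
      have 1: "\<bar>M - a ^ CARD('d) * p / covol\<bar> \<le> E" unfolding M_def p_def using \<alpha> by (rule sub)
      \<comment> \<open>Normalising by the actual number of points instead of
        \<open>a ^ CARD('d) / covol\<close> costs a second \<open>E\<close>.\<close>
      have "\<bar>p * (real (card P) - a ^ CARD('d) / covol)\<bar> \<le> 1 * E"
        unfolding abs_mult using p N by (intro mult_mono) auto
      hence "\<bar>p * real (card P) - a ^ CARD('d) * p / covol\<bar> \<le> E" by (simp add: algebra_simps)
      hence "\<bar>M - p * real (card P)\<bar> \<le> 2 * E" using 1 by linarith
      moreover have "M / card P - p = (M - p * real (card P)) / card P"
        using card by (simp add: diff_divide_distrib)
      hence "\<bar>M / card P - p\<bar> = \<bar>M - p * real (card P)\<bar> / card P" by (simp add: abs_divide)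
      ultimately show "\<bar>real (card (P \<inter> half_open_box 0 \<alpha>)) / real (card P) - (\<Prod>j\<in>UNIV. \<alpha> $ j)\<bar> \<le> 2 * E / card P"
        unfolding M_def[symmetric] p_def[symmetric] by (simp add: divide_right_mono)
    qed
    thus "star_discrepancy (lattice_points T a \<delta>) \<le>
      2 * C * (real n + 1) ^ (CARD('d) - 1) / real (card (lattice_points T a \<delta>))"
      by (simp add: P_def E_def mult.assoc)
  qed
qed

lemma lattice_points_discrepancy:
  "\<exists>C>0. \<forall>a \<delta>. 0 < a \<longrightarrow> 2 \<le> card (lattice_points T a \<delta>) \<longrightarrow>
    star_discrepancy (lattice_points T a \<delta>) \<le>
      C * (ln (card (lattice_points T a \<delta>)) ^ (CARD('d) - 1) / card (lattice_points T a \<delta>))"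
  and card_lattice_points_large: "\<exists>A. \<forall>a \<delta>. A \<le> a \<longrightarrow> k \<le> card (lattice_points T a \<delta>)"
proof -
  obtain C where C: "0 \<le> C" and aux: "\<forall>a \<delta> n. 0 < a \<longrightarrow> a ^ CARD('d) \<le> 2 ^ Suc n \<longrightarrow>
    \<bar>real (card (lattice_points T a \<delta>)) - a ^ CARD('d) / covol\<bar> \<le> C * (real n + 1) ^ (CARD('d) - 1) \<and>
    (lattice_points T a \<delta> \<noteq> {} \<longrightarrow> star_discrepancy (lattice_points T a \<delta>) \<le>
      2 * C * (real n + 1) ^ (CARD('d) - 1) / real (card (lattice_points T a \<delta>)))"
    using lattice_points_discrepancy_aux by (elim exE conjE)
  obtain M where M: "\<And>m. M \<le> m \<Longrightarrow> sqrt 2 ^ m \<le> 2 ^ m / covol - C * (real m + 1) ^ (CARD('d) - 1)"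
    using exp_minus_poly_growth[OF covol_pos] by blast
  have card_ge: "sqrt 2 ^ m \<le> real (card (lattice_points T a \<delta>))"
    if "M \<le> m" "0 < a" "2 ^ m \<le> a ^ CARD('d)" "a ^ CARD('d) \<le> 2 ^ Suc m" for m a \<delta>
  proof -
    have "2 ^ m / covol \<le> a ^ CARD('d) / covol" using that covol_pos by (intro divide_right_mono) auto
    moreover have "\<bar>real (card (lattice_points T a \<delta>)) - a ^ CARD('d) / covol\<bar> \<le> C * (real m + 1) ^ (CARD('d) - 1)"
      using aux that by blast
    ultimately show ?thesis using M[OF that(1)] by linarith
  qed
  \<comment> \<open>At \<open>m = 0\<close> the lower bound may fail, since \<open>v\<close> can be
    below 1.\<close>
  have dyadic: "\<exists>m. v \<le> 2 ^ Suc m \<and> (m = 0 \<or> 2 ^ m \<le> v)" for v :: real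
  proof -
    obtain n where "v < 2 ^ n" using real_arch_pow[of 2 v] by auto
    hence ex: "v \<le> 2 ^ Suc n" by (simp add: order_trans[OF less_imp_le])
    define m where "m = (LEAST m. v \<le> 2 ^ Suc m)"
    have "v \<le> 2 ^ Suc m" unfolding m_def using ex by (rule LeastI)
    moreover have "2 ^ m \<le> v" if "m = Suc k" for k
      using not_less_Least[of k "\<lambda>m. v \<le> 2 ^ Suc m"] that unfolding m_def by simp
    ultimately have "v \<le> 2 ^ Suc m \<and> (m = 0 \<or> 2 ^ m \<le> v)" by (cases m) simp_all
    thus ?thesis by blast
  qed
  \<comment> \<open>The first entry serves \<open>m \<ge> M\<close>, where
    \<open>N \<ge> sqrt 2 ^ m\<close> gives \<open>m + 1 \<le> 2 * m \<le> 4 / ln 2 * ln N\<close>;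
    the second serves the finitely many other \<open>m\<close>, where \<open>N \<ge> 2\<close>
    suffices.\<close>
  define L where "L = max (4 / ln 2) ((real M + 1) / ln 2)"
  have L: "0 < L" by (simp add: L_def less_max_iff_disj)
  show "\<exists>C>0. \<forall>a \<delta>. 0 < a \<longrightarrow> 2 \<le> card (lattice_points T a \<delta>) \<longrightarrow>
    star_discrepancy (lattice_points T a \<delta>) \<le>
      C * (ln (card (lattice_points T a \<delta>)) ^ (CARD('d) - 1) / card (lattice_points T a \<delta>))"
  proof (rule exI[of _ "2 * (C + 1) * L ^ (CARD('d) - 1)"], intro conjI allI impI)
    show "0 < 2 * (C + 1) * L ^ (CARD('d) - 1)" using C L by simp
    fix a \<delta> assume a: "0 < a" and card: "2 \<le> card (lattice_points T a \<delta>)"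
    define N where "N = real (card (lattice_points T a \<delta>))"
    have N: "2 \<le> N" using card by (simp add: N_def)
    hence ln2: "ln 2 \<le> ln N" by simp
    obtain m where m: "a ^ CARD('d) \<le> 2 ^ Suc m" "m = 0 \<or> 2 ^ m \<le> a ^ CARD('d)" using dyadic by blast
    have "real m + 1 \<le> L * ln N"
    proof (cases "m = 0 \<or> m < M")
      case True
      hence "real m + 1 \<le> real M + 1" by auto
      also have "\<dots> = (real M + 1) / ln 2 * ln 2" by simp
      also have "\<dots> \<le> L * ln N" using ln2 L by (intro mult_mono) (auto simp: L_def)
      finally show ?thesis .
    next
      case False
      hence "sqrt 2 ^ m \<le> N" unfolding N_def using m a by (intro card_ge) auto
      hence "ln (sqrt 2 ^ m) \<le> ln N" using N by (subst ln_le_cancel_iff) auto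
      hence "real m * (ln 2 / 2) \<le> ln N" by (simp add: ln_realpow ln_sqrt)
      hence "4 / ln 2 * (real m * (ln 2 / 2)) \<le> L * ln N" using L by (intro mult_mono) (auto simp: L_def)
      moreover have "4 / ln 2 * (real m * (ln 2 / 2)) = 2 * real m" by simp
      ultimately show ?thesis using False by simp
    qed
    hence "(real m + 1) ^ (CARD('d) - 1) \<le> (L * ln N) ^ (CARD('d) - 1)" by (intro power_mono) auto
    hence "2 * C * (real m + 1) ^ (CARD('d) - 1) \<le> 2 * (C + 1) * (L * ln N) ^ (CARD('d) - 1)"
      using C by (intro mult_mono) auto
    hence "2 * C * (real m + 1) ^ (CARD('d) - 1) / N \<le> 2 * (C + 1) * (L * ln N) ^ (CARD('d) - 1) / N"
      using N by (intro divide_right_mono) auto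
    moreover have "lattice_points T a \<delta> \<noteq> {}" using card by auto
    with aux a m have "star_discrepancy (lattice_points T a \<delta>) \<le> 2 * C * (real m + 1) ^ (CARD('d) - 1) / N"
      unfolding N_def by blast
    ultimately show "star_discrepancy (lattice_points T a \<delta>) \<le>
      2 * (C + 1) * L ^ (CARD('d) - 1) *
        (ln (card (lattice_points T a \<delta>)) ^ (CARD('d) - 1) / card (lattice_points T a \<delta>))"
      by (simp add: power_mult_distrib mult.assoc flip: N_def)
  qed
  show "\<exists>A. \<forall>a \<delta>. A \<le> a \<longrightarrow> k \<le> card (lattice_points T a \<delta>)"
  proof -
    obtain m where "real k < sqrt 2 ^ m" using real_arch_pow[of "sqrt 2" "real k"] by auto
    \<comment> \<open>\<open>Suc m\<close> makes \<open>l\<close> positive below, so that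
      \<open>dyadic\<close> yields its lower bound.\<close>
    define m0 where "m0 = max M (Suc m)"
    show ?thesis
    proof (intro exI[of _ "2 ^ Suc m0"] allI impI)
      fix a :: real and \<delta> :: "real ^ 'd" assume a: "2 ^ Suc m0 \<le> a"
      have "(1 :: real) \<le> 2 ^ Suc m0" by (rule one_le_power) simp
      hence a1: "1 \<le> a" using a by linarith
      obtain l where l: "a ^ CARD('d) \<le> 2 ^ Suc l" "l = 0 \<or> 2 ^ l \<le> a ^ CARD('d)" using dyadic by blast
      have "2 ^ Suc m0 \<le> a ^ 1" using a by simp
      also have "a ^ 1 \<le> a ^ CARD('d)" using a1 by (intro power_increasing) auto
      also have "\<dots> \<le> 2 ^ Suc l" by (rule l(1))
      finally have "(2 :: real) ^ Suc m0 \<le> 2 ^ Suc l" .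
      hence m0: "m0 \<le> l" by (subst (asm) power_increasing_iff) auto
      have "real k < sqrt 2 ^ m" by fact
      also have "\<dots> \<le> sqrt 2 ^ l" using m0 by (intro power_increasing) (auto simp: m0_def)
      also have "\<dots> \<le> real (card (lattice_points T a \<delta>))"
        using m0 l a1 by (intro card_ge) (auto simp: m0_def)
      finally show "k \<le> card (lattice_points T a \<delta>)" by simp
    qed
  qed
qed

section \<open>Separation and covering radii\<close>

lemma lattice_points_separation:
  assumes a: "0 < a" and p: "1 \<le> p" and card: "2 \<le> card (lattice_points T a \<delta>)"
  shows "min 1 nm / (2 * a) \<le> separation_radius p (lattice_points T a \<delta>)"
proof -
  define P where "P = lattice_points T a \<delta>"
  define S where "S = {p_norm p (x - y) | x y. x \<in> P \<and> y \<in> P \<and> x \<noteq> y}"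
  have "S \<subseteq> (\<lambda>(x, y). p_norm p (x - y)) ` (P \<times> P)" by (auto simp: S_def)
  hence fin: "finite S"
    by (rule finite_subset) (simp add: P_def finite_lattice_points[OF a])
  have "\<not> (\<exists>x. P \<subseteq> {x})" using card card_mono[of "{x}" P for x] by (fastforce simp: P_def)
  then obtain x y where "x \<in> P" "y \<in> P" "x \<noteq> y" by blast
  hence ne: "S \<noteq> {}" by (auto simp: S_def)
  have "min 1 nm / a \<le> p_norm p (x - y)" if P: "x \<in> P" "y \<in> P" "x \<noteq> y" for x y
  proof -
    obtain x' y' where xy: "x' \<in> X" "x = inverse a *\<^sub>R (x' - \<delta>)" "y' \<in> X" "y = inverse a *\<^sub>R (y' - \<delta>)"
      using P(1,2) by (auto simp: P_def lattice_points_def)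
    define w where "w = x' - y'"
    have w: "w \<in> X" "w \<noteq> 0" using X_diff xy P by (auto simp: w_def)
    \<comment> \<open>Otherwise all factors are below 1, and the product is at most a single
      coordinate, which is below \<open>nm\<close>.\<close>
    have "\<exists>j. min 1 nm \<le> \<bar>w $ j\<bar>"
    proof (rule ccontr)
      assume "\<not> ?thesis"
      hence small: "\<bar>w $ j\<bar> < 1" "\<bar>w $ j\<bar> < nm" for j by (auto simp: not_le)
      obtain e :: 'd where True by blast
      have "nm \<le> (\<Prod>j\<in>UNIV. \<bar>w $ j\<bar>)" by (rule nm_le[OF w])
      also have "\<dots> = \<bar>w $ e\<bar> * (\<Prod>j\<in>UNIV - {e}. \<bar>w $ j\<bar>)" by (subst prod.remove[of _ e]) auto
      also have "\<dots> \<le> \<bar>w $ e\<bar>" using small by (intro mult_left_le prod_le_1) (auto intro: less_imp_le)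
      also have "\<dots> < nm" by (rule small)
      finally show False by simp
    qed
    then obtain j where j: "min 1 nm \<le> \<bar>w $ j\<bar>" by blast
    have "x - y = inverse a *\<^sub>R w" unfolding xy w_def by (simp add: algebra_simps)
    hence "\<bar>w $ j\<bar> / a \<le> p_norm p (x - y)"
      using abs_component_le_p_norm[OF p, of "x - y" j] a by (simp add: abs_mult divide_inverse mult.commute)
    moreover have "min 1 nm / a \<le> \<bar>w $ j\<bar> / a" using j a by (intro divide_right_mono) auto
    ultimately show ?thesis by linarith
  qed
  hence "min 1 nm / a \<le> Min S" using fin ne by (auto simp: S_def)
  thus ?thesis unfolding separation_radius_def P_def[symmetric] S_def[symmetric] by simp
qed

text \<open>The tile containing a point yields a lattice point nearby, but near the boundary it may
  fall outside the cube; so the point is first pulled inwards by a distance O(1) in lattice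
  units.\<close>

lemma lattice_points_covering:
  "\<exists>L>0. \<forall>a \<delta> p. 0 < a \<longrightarrow> 1 \<le> p \<longrightarrow> lattice_points T a \<delta> \<noteq> {} \<longrightarrow>
    covering_radius p (lattice_points T a \<delta>) \<le> L / a"
proof -
  define L where "L = (\<Sum>j\<in>UNIV. \<Sum>i\<in>UNIV. \<bar>T $ j $ i\<bar>) + 1"
  have L: "1 \<le> L" by (auto simp: L_def intro!: sum_nonneg)
  have cell: "\<bar>z $ j\<bar> < L" if "z \<in> cell" for z j
  proof -
    have "\<bar>z $ j\<bar> \<le> (\<Sum>i\<in>UNIV. \<bar>T $ j $ i\<bar>)" by (rule cell_abs_le[OF that])
    also have "\<dots> \<le> (\<Sum>j\<in>UNIV. \<Sum>i\<in>UNIV. \<bar>T $ j $ i\<bar>)"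
      by (rule member_le_sum) (auto intro: sum_nonneg)
    finally show ?thesis by (simp add: L_def)
  qed
  show ?thesis
  proof (rule exI[of _ "CARD('d) * (3 * L)"], intro conjI allI impI)
    show "0 < CARD('d) * (3 * L)" using L by simp
    fix a \<delta> and p :: ereal
    assume a: "0 < a" and p: "1 \<le> p" and ne: "lattice_points T a \<delta> \<noteq> {}"
    define P where "P = lattice_points T a \<delta>"
    have near: "\<exists>y\<in>P. \<forall>j. \<bar>(x - y) $ j\<bar> \<le> 3 * L / a" if "x \<in> cbox 0 1" for x
    \<comment> \<open>If the scaled cube is too small for pulling inwards, its whole side is already
      below \<open>3 * L\<close>, and any point of \<open>P\<close> will do.\<close>
    proof (cases "a < 3 * L")
      case True
      obtain y where y: "y \<in> P" using ne by (auto simp: P_def)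
      have "\<bar>(x - y) $ j\<bar> \<le> 3 * L / a" for j
      proof -
        have "0 \<le> y $ j" "y $ j < 1" "0 \<le> x $ j" "x $ j \<le> 1"
          using y that by (auto simp: P_def lattice_points_def half_open_box_def mem_box_cart)
        hence "\<bar>(x - y) $ j\<bar> \<le> 1" by simp
        also have "1 \<le> 3 * L / a" using True a by simp
        finally show ?thesis .
      qed
      thus ?thesis using y by blast
    next
      case False
      \<comment> \<open>Clamping to \<open>[L, a - 2 * L]\<close> moves a coordinate by at most
        \<open>2 * L\<close>; a lattice point within \<open>L\<close> then stays in
        \<open>[0, a)\<close>.\<close>
      define z where "z = (\<chi> j. max L (min (a * x $ j) (a - 2 * L)))"
      have x: "0 \<le> a * x $ j" "a * x $ j \<le> a" for j
        using that a by (auto simp: mem_box_cart mult_left_le)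
      have z: "L \<le> z $ j" "z $ j \<le> a - L" "\<bar>a * x $ j - z $ j\<bar> \<le> 2 * L" for j
        using False L x[of j] by (auto simp: z_def max_def min_def)
      obtain x' where x': "x' \<in> X" "z + \<delta> - x' \<in> cell" using cell_tiling[of "z + \<delta>"] by blast
      define y where "y = inverse a *\<^sub>R (x' - \<delta>)"
      have d: "\<bar>z $ j - (x' - \<delta>) $ j\<bar> < L" for j using cell[OF x'(2), of j] by (simp add: algebra_simps)
      have "0 \<le> (x' - \<delta>) $ j \<and> (x' - \<delta>) $ j < a" for j using d[of j] z[of j] by linarith
      hence "y \<in> half_open_box 0 1" using a by (simp add: y_def half_open_box_def field_simps)
      hence "y \<in> P" using x'(1) by (auto simp: P_def lattice_points_def y_def)
      moreover have "\<bar>(x - y) $ j\<bar> \<le> 3 * L / a" for j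
      proof -
        have "a * (x - y) $ j = a * x $ j - (x' - \<delta>) $ j" using a by (simp add: y_def field_simps)
        hence "\<bar>a * (x - y) $ j\<bar> \<le> 3 * L" using d[of j] z(3)[of j] by linarith
        thus ?thesis using a by (simp add: abs_mult pos_le_divide_eq mult.commute)
      qed
      ultimately show ?thesis by blast
    qed
    have "covering_radius p P \<le> CARD('d) * (3 * L / a)"
      unfolding covering_radius_def
    proof (rule cSUP_least)
      have "(0 :: real ^ 'd) \<in> cbox 0 1" by (simp add: mem_box_cart)
      thus "cbox 0 (1 :: real ^ 'd) \<noteq> {}" by blast
      fix x :: "real ^ 'd" assume "x \<in> cbox 0 1"
      then obtain y where y: "y \<in> P" "\<And>j. \<bar>(x - y) $ j\<bar> \<le> 3 * L / a" using near by blast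
      have "(MIN y\<in>P. p_norm p (x - y)) \<le> p_norm p (x - y)"
        using finite_lattice_points[OF a, of \<delta>] y(1) by (intro Min_le) (auto simp: P_def)
      also have "\<dots> \<le> CARD('d) * (3 * L / a)" by (rule p_norm_le[OF p y(2)])
      finally show "(MIN y\<in>P. p_norm p (x - y)) \<le> CARD('d) * (3 * L / a)" .
    qed
    thus "covering_radius p (lattice_points T a \<delta>) \<le> CARD('d) * (3 * L) / a" by (simp add: P_def)
  qed
qed

text \<open>Both radii have order \<open>1 / a\<close> with constants independent of shift and
  \<open>p\<close>, so the scale cancels.\<close>

lemma lattice_points_mesh_ratio:
  "\<exists>C>0. \<forall>a \<delta> p. 0 < a \<longrightarrow> 1 \<le> p \<longrightarrow> 2 \<le> card (lattice_points T a \<delta>) \<longrightarrow>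
    mesh_ratio p (lattice_points T a \<delta>) \<le> C"
proof -
  obtain L where L: "0 < L" and cov: "\<And>a \<delta> p. 0 < a \<Longrightarrow> 1 \<le> p \<Longrightarrow> lattice_points T a \<delta> \<noteq> {} \<Longrightarrow>
    covering_radius p (lattice_points T a \<delta>) \<le> L / a"
    using lattice_points_covering by blast
  define c where "c = min 1 nm"
  have c: "0 < c" using nm_pos by (simp add: c_def)
  show ?thesis
  proof (rule exI[of _ "2 * L / c"], intro conjI allI impI)
    show "0 < 2 * L / c" using L c by simp
    fix a \<delta> and p :: ereal
    assume a: "0 < a" and p: "1 \<le> p" and card: "2 \<le> card (lattice_points T a \<delta>)"
    have "lattice_points T a \<delta> \<noteq> {}" using card by auto
    note cov = cov[OF a p this]
    have sep: "c / (2 * a) \<le> separation_radius p (lattice_points T a \<delta>)"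
      unfolding c_def by (rule lattice_points_separation[OF a p card])
    have pos: "0 < c / (2 * a)" using a c by simp
    have "mesh_ratio p (lattice_points T a \<delta>) \<le> L / a / separation_radius p (lattice_points T a \<delta>)"
      unfolding mesh_ratio_def using cov sep pos by (intro divide_right_mono) auto
    also have "\<dots> \<le> L / a / (c / (2 * a))"
      using sep pos L a by (intro divide_left_mono mult_pos_pos) auto
    also have "\<dots> = 2 * L / c" using a c by (simp add: field_simps)
    finally show "mesh_ratio p (lattice_points T a \<delta>) \<le> 2 * L / c" .
  qed
qed

end

theorem theorem3p1:
  fixes T :: "real ^ 'd ^ 'd"
    and n :: nat
    and a0 :: real
    and a :: "nat \<Rightarrow> real"
    and \<delta> :: "nat \<Rightarrow> real ^ 'd"
    and N :: "nat \<Rightarrow> nat"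
  assumes "invertible T"
    and "admissible (lattice_of T)"
    and "n \<ge> 2"
    and "a0 > 0"
    and "\<And>i. i \<ge> 1 \<Longrightarrow> a i = a0 * real n ^ i"
    and "\<And>i. i \<ge> 1 \<Longrightarrow> N i = card (lattice_points T (a i) (\<delta> i))"
    and "\<And>i. i \<ge> 1 \<Longrightarrow> N i \<ge> 2"
  shows "(\<forall>p\<ge>1. quasi_uniform_family p {lattice_points T (a i) (\<delta> i) | i. i \<ge> 1}) \<and>
    (\<exists>C>0. \<forall>i\<ge>1. star_discrepancy (lattice_points T (a i) (\<delta> i))
        \<le> C * (ln (real (N i)) ^ (CARD('d) - 1) / real (N i))) \<and>
    (\<forall>\<delta>'. (real n - 1) *\<^sub>R \<delta>' \<in> lattice_of T \<longrightarrow>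
        (\<forall>i\<ge>1. lattice_points T (a i) \<delta>' \<subseteq> lattice_points T (a (i + 1)) \<delta>')) \<and>
    (\<forall>\<delta>'. \<forall>i\<ge>1. lattice_points T (a i) (a i *\<^sub>R \<delta>')
        \<subseteq> lattice_points T (a (i + 1)) (a (i + 1) *\<^sub>R \<delta>'))"
proof -
  interpret admissible_lattice T using assms(1,2) by unfold_locales
  have a_pos: "0 < a i" if "i \<ge> 1" for i using assms(3-5) that by simp
  have card2: "2 \<le> card (lattice_points T (a i) (\<delta> i))" if "i \<ge> 1" for i
    using assms(6,7)[OF that] by simp
  have a_Suc: "a (i + 1) = real n * a i" if "i \<ge> 1" for i using assms(5) that by simp
  have X_scale: "real n *\<^sub>R x \<in> X" if "x \<in> X" for x
  proof -
    have "real m *\<^sub>R x \<in> X" for m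
      by (induction m) (use X_0 X_add that in \<open>auto simp: scaleR_add_left\<close>)
    thus ?thesis .
  qed
  \<comment> \<open>The point given by \<open>x\<close> at level \<open>i\<close> reappears at level
    \<open>i + 1\<close> with lattice vector \<open>n (x - \<epsilon>) + \<epsilon>'\<close>. For a
    constant shift this is \<open>n x - (n - 1) \<delta>'\<close>; for shifts growing with
    \<open>a\<close> it is just \<open>n x\<close>.\<close>
  have nested: "lattice_points T (a i) \<epsilon> \<subseteq> lattice_points T (a (i + 1)) \<epsilon>'"
    if i: "i \<ge> 1" and \<epsilon>: "\<And>x. x \<in> X \<Longrightarrow> real n *\<^sub>R (x - \<epsilon>) + \<epsilon>' \<in> X" for i \<epsilon> \<epsilon>'
  proof -
    have "inverse (a i) *\<^sub>R (x - \<epsilon>) = inverse (a (i + 1)) *\<^sub>R ((real n *\<^sub>R (x - \<epsilon>) + \<epsilon>') - \<epsilon>')" for x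
      using a_Suc[OF i] assms(3) by simp
    thus ?thesis unfolding lattice_points_def using \<epsilon> by blast
  qed
  have "quasi_uniform_family p {lattice_points T (a i) (\<delta> i) | i. i \<ge> 1}" if p: "1 \<le> p" for p
    unfolding quasi_uniform_family_def
  proof (intro conjI)
    show "\<forall>P\<in>{lattice_points T (a i) (\<delta> i) | i. i \<ge> 1}. finite P \<and> P \<subseteq> cbox 0 1 \<and> card P \<ge> 2"
      using finite_lattice_points[OF a_pos] card2 half_open_box_subset(2)[of 0 "1 :: real ^ 'd"]
      by (auto simp: lattice_points_def)
    show "(SUP P\<in>{lattice_points T (a i) (\<delta> i) | i. i \<ge> 1}. enat (card P)) = \<infinity>"
      unfolding top_enat_def[symmetric] SUP_eq_top_iff
    proof (intro allI impI)
      fix x :: enat assume "x < top"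
      then obtain k where k: "x = enat k" by (cases x) (auto simp: top_enat_def)
      obtain A where A: "\<And>b \<delta>. A \<le> b \<Longrightarrow> Suc k \<le> card (lattice_points T b \<delta>)"
        using card_lattice_points_large[of "Suc k"] by blast
      obtain m where "A / a0 < real n ^ m" using real_arch_pow[of "real n" "A / a0"] assms(3) by auto
      also have "real n ^ m \<le> real n ^ Suc m" using assms(3) by (intro power_increasing) auto
      finally have "A / a0 \<le> real n ^ Suc m" by simp
      hence "A \<le> a (Suc m)" using assms(4,5) by (simp add: pos_divide_le_eq mult.commute)
      hence "enat k < enat (card (lattice_points T (a (Suc m)) (\<delta> (Suc m))))" using A by (simp add: Suc_le_eq)
      moreover have "Suc m \<ge> 1" by simp
      ultimately show "\<exists>P\<in>{lattice_points T (a i) (\<delta> i) | i. i \<ge> 1}. x < enat (card P)"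
        unfolding k by blast
    qed
    show "\<exists>C>0. \<forall>P\<in>{lattice_points T (a i) (\<delta> i) | i. i \<ge> 1}. mesh_ratio p P \<le> C"
      using lattice_points_mesh_ratio p a_pos card2 by blast
  qed
  moreover have "\<exists>C>0. \<forall>i\<ge>1. star_discrepancy (lattice_points T (a i) (\<delta> i))
        \<le> C * (ln (real (N i)) ^ (CARD('d) - 1) / real (N i))"
  proof -
    obtain C where "0 < C" and C: "\<And>b \<delta>. 0 < b \<Longrightarrow> 2 \<le> card (lattice_points T b \<delta>) \<Longrightarrow>
      star_discrepancy (lattice_points T b \<delta>) \<le>
        C * (ln (card (lattice_points T b \<delta>)) ^ (CARD('d) - 1) / card (lattice_points T b \<delta>))"
      using lattice_points_discrepancy by blast
    thus ?thesis using a_pos card2 assms(6) by (intro exI[of _ C]) simp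
  qed
  moreover have "lattice_points T (a i) \<delta>' \<subseteq> lattice_points T (a (i + 1)) \<delta>'"
    if "(real n - 1) *\<^sub>R \<delta>' \<in> X" "i \<ge> 1" for \<delta>' i
  proof (rule nested[OF that(2)])
    fix x assume "x \<in> X"
    hence "real n *\<^sub>R x - (real n - 1) *\<^sub>R \<delta>' \<in> X" using X_scale X_diff that(1) by blast
    thus "real n *\<^sub>R (x - \<delta>') + \<delta>' \<in> X" by (simp add: algebra_simps)
  qed
  moreover have "lattice_points T (a i) (a i *\<^sub>R \<delta>') \<subseteq> lattice_points T (a (i + 1)) (a (i + 1) *\<^sub>R \<delta>')"
    if "i \<ge> 1" for \<delta>' i
    by (rule nested[OF that]) (simp add: a_Suc[OF that, simplified] X_scale scaleR_diff_right)
  ultimately show ?thesis by blast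
qed

end
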